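(* Let $\mathcal{K}$ be a field, $\Gamma\leq\mathbb{R}$ an additive subgroup, and $\Lambda=\Lambda^{\mathcal{K},\Gamma}$. If $(C,\ell_C)$ and $(D,\ell_D)$ are orthogonalizable $\Lambda$-spaces, then any $\Lambda$-linear map $A\colon C\to D$ has a singular value decomposition.
   Context: **Novikov field.** $\Lambda=\Lambda^{\mathcal{K},\Gamma}$ is the field of formal sums $\sum_{g\in\Gamma}a_gT^g$ with $a_g\in\mathcal{K}$ such that for every $C\in\mathbb{R}$ only finitely many $g<C$ have $a_g\neq 0$, with power-series addition and multiplication. Its valuation is $\nu(\sum a_gT^g)=\min\{g\mid a_g\neq 0\}$, $\nu(0)=\infty$. **Orthogonalizable spaces.** A non-Archimedean normed vector space over $\Lambda$ is a pair $(C,\ell)$ with $C$ a $\Lambda$-vector space and $\ell\colon C\to\mathbb{R}\cup\{-\infty\}$ (filtration function) satisfying: $\ell(x)=-\infty$ iff $x=0$; $\ell(\lambda x)=\ell(x)-\nu(\lambda)$; $\ell(x+y)\leq\max\{\ell(x),\ell(y)\}$. A finite ordered collection $(w_1,\dots,w_r)$ in $C$ is orthogonal if $\ell(\sum_i\lambda_iw_i)=\max_i\ell(\lambda_iw_i)$ for all $\lambda_i\in\Lambda$. An orthogonalizable $\Lambda$-space is a finite-dimensional non-Archimedean normed vector space admitting an orthogonal basis. **Singular value decomposition.** Let $A\colon C\to D$ be a $\Lambda$-linear map of rank $r$ between orthogonalizable $\Lambda$-spaces. A singular value decomposition of $A$ is a choice of orthogonal ordered bases $(y_1,\dots,y_n)$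 for $C$ and $(x_1,\dots,x_m)$ for $D$ such that: (i) $(y_{r+1},\dots,y_n)$ is an orthogonal ordered basis for $\ker A$; (ii) $(x_1,\dots,x_r)$ is an orthogonal ordered basis for $\mathrm{Im}\,A$; (iii) $Ay_i=x_i$ for $i\in\{1,\dots,r\}$; (iv) $\ell_C(y_1)-\ell_D(x_1)\geq\cdots\geq\ell_C(y_r)-\ell_D(x_r)$. *)

theory Defs
  imports
    "HOL-Library.Extended_Real"
    "Jordan_Normal_Form.Missing_VectorSpace"
begin

section \<open>The Novikov field\<close>

definition real_group :: "real monoid" where
  "real_group = \<lparr>carrier = UNIV, monoid.mult = (+), one = 0\<rparr>"

text \<open>
  A formal sum of terms \<open>a\<^sub>g T\<^sup>g\<close> with \<open>g \<in> \<Gamma>\<close> is encoded as its coefficient function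
  on all of the reals, extended by zero outside \<open>\<Gamma>\<close>. In the convolution product only those
  \<open>h\<close> contribute for which both factors are nonzero; there are finitely many of them.
\<close>

definition novikov_ring :: "('k, 'm) ring_scheme \<Rightarrow> real set \<Rightarrow> (real \<Rightarrow> 'k) ring" where
  "novikov_ring K \<Gamma> =
    \<lparr>carrier = {a. (\<forall>g. a g \<in> carrier K) \<and> (\<forall>g. g \<notin> \<Gamma> \<longrightarrow> a g = \<zero>\<^bsub>K\<^esub>) \<and>
                   (\<forall>C. finite {g. g < C \<and> a g \<noteq> \<zero>\<^bsub>K\<^esub>})},
     monoid.mult = (\<lambda>a b g. \<Oplus>\<^bsub>K\<^esub>h\<in>{h. a h \<noteq> \<zero>\<^bsub>K\<^esub> \<and> b (g - h) \<noteq> \<zero>\<^bsub>K\<^esub>}. a h \<otimes>\<^bsub>K\<^esub> b (g - h)),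
     one = (\<lambda>g. if g = 0 then \<one>\<^bsub>K\<^esub> else \<zero>\<^bsub>K\<^esub>),
     ring.zero = (\<lambda>g. \<zero>\<^bsub>K\<^esub>),
     add = (\<lambda>a b g. a g \<oplus>\<^bsub>K\<^esub> b g)\<rparr>"

text \<open>On a nonzero element \<open>LEAST\<close> is the minimum of the support, which is attained.\<close>

definition novikov_val :: "('k, 'm) ring_scheme \<Rightarrow> (real \<Rightarrow> 'k) \<Rightarrow> ereal" where
  "novikov_val K a =
    (if \<forall>g. a g = \<zero>\<^bsub>K\<^esub> then \<infinity> else ereal (LEAST g. a g \<noteq> \<zero>\<^bsub>K\<^esub>))"

subsection \<open>The Novikov ring of a field is a field\<close>

lemma real_group_simps [simp]:
  "carrier real_group = UNIV" "x \<otimes>\<^bsub>real_group\<^esub> y = x + y" "\<one>\<^bsub>real_group\<^esub> = 0"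
  by (simp_all add: real_group_def)

lemma real_group: "comm_group real_group"
  by (rule comm_groupI) (auto intro: exI[of _ "- x" for x :: real])

lemma inv_real_group [simp]: "inv\<^bsub>real_group\<^esub> x = - x"
proof -
  interpret comm_group real_group by (rule real_group)
  show ?thesis by (rule inv_equality) auto
qed

locale novikov = field K for K :: "('k, 'm) ring_scheme" (structure) +
  fixes \<Gamma> :: "real set"
  assumes subgroup: "subgroup \<Gamma> real_group"
begin

abbreviation \<Lambda> where "\<Lambda> \<equiv> novikov_ring K \<Gamma>"

lemma zero_Gamma: "0 \<in> \<Gamma>"
  and add_Gamma: "x \<in> \<Gamma> \<Longrightarrow> y \<in> \<Gamma> \<Longrightarrow> x + y \<in> \<Gamma>"
  and uminus_Gamma: "x \<in> \<Gamma> \<Longrightarrow> - x \<in> \<Gamma>"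
  using subgroup.one_closed[OF subgroup] subgroup.m_closed[OF subgroup, of x y]
    subgroup.m_inv_closed[OF subgroup, of x] by simp_all

lemma carrier_iff:
  "a \<in> carrier \<Lambda> \<longleftrightarrow> (\<forall>g. a g \<in> carrier K) \<and> (\<forall>g. a g \<noteq> \<zero> \<longrightarrow> g \<in> \<Gamma>) \<and>
     (\<forall>C. finite {g. g < C \<and> a g \<noteq> \<zero>})"
  by (auto simp: novikov_ring_def)

lemma coeff_closed: "a \<in> carrier \<Lambda> \<Longrightarrow> a g \<in> carrier K"
  and coeff_Gamma: "a \<in> carrier \<Lambda> \<Longrightarrow> a g \<noteq> \<zero> \<Longrightarrow> g \<in> \<Gamma>"
  and coeff_finite: "a \<in> carrier \<Lambda> \<Longrightarrow> finite {g. g < C \<and> a g \<noteq> \<zero>}"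
  by (auto simp: carrier_iff)

lemma novikov_simps:
  "(a \<oplus>\<^bsub>\<Lambda>\<^esub> b) g = a g \<oplus> b g" "\<zero>\<^bsub>\<Lambda>\<^esub> g = \<zero>" "\<one>\<^bsub>\<Lambda>\<^esub> g = (if g = 0 then \<one> else \<zero>)"
  by (simp_all add: novikov_ring_def)

lemma novikov_mult:
  "(a \<otimes>\<^bsub>\<Lambda>\<^esub> b) g = (\<Oplus>h\<in>{h. a h \<noteq> \<zero> \<and> b (g - h) \<noteq> \<zero>}. a h \<otimes> b (g - h))"
  by (simp add: novikov_ring_def)

lemma support_bounded_below:
  assumes "a \<in> carrier \<Lambda>"
  obtains M where "\<And>g. a g \<noteq> \<zero> \<Longrightarrow> M \<le> g"
proof (cases "{g. g < 0 \<and> a g \<noteq> \<zero>} = {}")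
  case True
  show ?thesis by (rule that[of 0]) (use True in force)
next
  case False
  let ?S = "{g. g < 0 \<and> a g \<noteq> \<zero>}"
  have fin: "finite ?S" using coeff_finite[OF assms] .
  show ?thesis
  proof (rule that[of "Min ?S"])
    fix g assume g: "a g \<noteq> \<zero>"
    show "Min ?S \<le> g"
    proof (cases "g < 0")
      case True
      thus ?thesis using fin g by (auto intro: Min_le)
    next
      case ge: False
      have "Min ?S \<in> ?S" using Min_in[OF fin False] .
      thus ?thesis using ge by simp
    qed
  qed
qed

lemma support_Min:
  assumes "a \<in> carrier \<Lambda>" "a g1 \<noteq> \<zero>"
  obtains g0 where "a g0 \<noteq> \<zero>" "\<And>g. a g \<noteq> \<zero> \<Longrightarrow> g0 \<le> g"
proof -
  let ?S = "{g. g < g1 + 1 \<and> a g \<noteq> \<zero>}"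
  have fin: "finite ?S" using coeff_finite[OF assms(1)] .
  have g1: "g1 \<in> ?S" using assms by simp
  have m: "Min ?S \<in> ?S" using Min_in[OF fin] g1 by blast
  show ?thesis
  proof (rule that[of "Min ?S"])
    show "a (Min ?S) \<noteq> \<zero>" using m by simp
    fix g assume g: "a g \<noteq> \<zero>"
    show "Min ?S \<le> g"
    proof (cases "g < g1 + 1")
      case True
      thus ?thesis using fin g by (auto intro: Min_le)
    next
      case False
      thus ?thesis using m by simp
    qed
  qed
qed

lemma finite_pairs:
  assumes a: "a \<in> carrier \<Lambda>" and b: "b \<in> carrier \<Lambda>"
  shows "finite {h. a h \<noteq> \<zero> \<and> b (g - h) \<noteq> \<zero>}"
proof -
  obtain M where M: "\<And>g. b g \<noteq> \<zero> \<Longrightarrow> M \<le> g" using support_bounded_below[OF b] by blast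
  have "{h. a h \<noteq> \<zero> \<and> b (g - h) \<noteq> \<zero>} \<subseteq> {h. h < g - M + 1 \<and> a h \<noteq> \<zero>}"
    using M by force
  thus ?thesis using coeff_finite[OF a] finite_subset by blast
qed

lemma mult_eq:
  assumes a: "a \<in> carrier \<Lambda>" and b: "b \<in> carrier \<Lambda>" and fin: "finite A"
    and sub: "\<And>h. a h \<noteq> \<zero> \<Longrightarrow> b (g - h) \<noteq> \<zero> \<Longrightarrow> h \<in> A"
  shows "(a \<otimes>\<^bsub>\<Lambda>\<^esub> b) g = (\<Oplus>h\<in>A. a h \<otimes> b (g - h))"
  unfolding novikov_mult
  by (rule add.finprod_mono_neutral_cong_left)
    (use fin sub coeff_closed[OF a] coeff_closed[OF b] in \<open>auto simp: Pi_def\<close>)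

lemma mult_nonzero_coeff:
  assumes "a \<in> carrier \<Lambda>" "b \<in> carrier \<Lambda>" "(a \<otimes>\<^bsub>\<Lambda>\<^esub> b) g \<noteq> \<zero>"
  obtains h where "a h \<noteq> \<zero>" "b (g - h) \<noteq> \<zero>"
proof -
  have "{h. a h \<noteq> \<zero> \<and> b (g - h) \<noteq> \<zero>} \<noteq> {}"
    using assms(3) unfolding novikov_mult by (metis finsum_empty)
  thus ?thesis using that by blast
qed

lemma mult_closed:
  assumes a: "a \<in> carrier \<Lambda>" and b: "b \<in> carrier \<Lambda>"
  shows "a \<otimes>\<^bsub>\<Lambda>\<^esub> b \<in> carrier \<Lambda>"
  unfolding carrier_iff
proof (intro conjI allI impI)
  fix g
  show "(a \<otimes>\<^bsub>\<Lambda>\<^esub> b) g \<in> carrier K"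
    unfolding novikov_mult by (rule finsum_closed) (use coeff_closed a b in auto)
next
  fix g assume "(a \<otimes>\<^bsub>\<Lambda>\<^esub> b) g \<noteq> \<zero>"
  then obtain h where "a h \<noteq> \<zero>" "b (g - h) \<noteq> \<zero>" using mult_nonzero_coeff[OF a b] by blast
  hence "h + (g - h) \<in> \<Gamma>" using coeff_Gamma a b add_Gamma by blast
  thus "g \<in> \<Gamma>" by simp
next
  fix C
  obtain M where M: "\<And>g. a g \<noteq> \<zero> \<Longrightarrow> M \<le> g" using support_bounded_below[OF a] by blast
  obtain N where N: "\<And>g. b g \<noteq> \<zero> \<Longrightarrow> N \<le> g" using support_bounded_below[OF b] by blast
  let ?A = "{h. h < C - N \<and> a h \<noteq> \<zero>}" and ?B = "{h. h < C - M \<and> b h \<noteq> \<zero>}"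
  have "{g. g < C \<and> (a \<otimes>\<^bsub>\<Lambda>\<^esub> b) g \<noteq> \<zero>} \<subseteq> (\<lambda>(x, y). x + y) ` (?A \<times> ?B)"
  proof
    fix g assume "g \<in> {g. g < C \<and> (a \<otimes>\<^bsub>\<Lambda>\<^esub> b) g \<noteq> \<zero>}"
    then obtain h where h: "a h \<noteq> \<zero>" "b (g - h) \<noteq> \<zero>" and g: "g < C"
      using mult_nonzero_coeff[OF a b] by blast
    have "(h, g - h) \<in> ?A \<times> ?B" using M[OF h(1)] N[OF h(2)] h g by auto
    moreover have "g = (\<lambda>(x, y). x + y) (h, g - h)" by simp
    ultimately show "g \<in> (\<lambda>(x, y). x + y) ` (?A \<times> ?B)" by blast
  qed
  thus "finite {g. g < C \<and> (a \<otimes>\<^bsub>\<Lambda>\<^esub> b) g \<noteq> \<zero>}"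
    by (rule finite_subset) (use coeff_finite a b in auto)
qed

lemma add_closed:
  assumes a: "a \<in> carrier \<Lambda>" and b: "b \<in> carrier \<Lambda>"
  shows "a \<oplus>\<^bsub>\<Lambda>\<^esub> b \<in> carrier \<Lambda>"
  unfolding carrier_iff novikov_simps
proof (intro conjI allI impI)
  fix g C
  show "a g \<oplus> b g \<in> carrier K" using coeff_closed a b by auto
  have *: "a h \<noteq> \<zero> \<or> b h \<noteq> \<zero>" if "a h \<oplus> b h \<noteq> \<zero>" for h using that by force
  show "g \<in> \<Gamma>" if "a g \<oplus> b g \<noteq> \<zero>" using *[OF that] coeff_Gamma a b by blast
  show "finite {g. g < C \<and> a g \<oplus> b g \<noteq> \<zero>}"
    by (rule finite_subset[OF _ finite_UnI[OF coeff_finite[OF a, of C] coeff_finite[OF b, of C]]])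
      (use * in auto)
qed

lemma uminus_closed:
  assumes a: "a \<in> carrier \<Lambda>"
  shows "(\<lambda>g. \<ominus> a g) \<in> carrier \<Lambda>"
proof -
  have "\<ominus> a g = \<zero> \<longleftrightarrow> a g = \<zero>" for g
    using coeff_closed[OF a] by (metis minus_minus minus_zero)
  thus ?thesis using assms unfolding carrier_iff by auto
qed

lemma zero_novikov_closed: "\<zero>\<^bsub>\<Lambda>\<^esub> \<in> carrier \<Lambda>"
  by (auto simp: carrier_iff novikov_simps)

lemma monomial_closed:
  assumes "t \<in> \<Gamma>" shows "(\<lambda>g. if g = t then \<one> else \<zero>) \<in> carrier \<Lambda>"
  unfolding carrier_iff
  using assms by (auto intro: finite_subset[of _ "{t}"])

lemma mult_comm:
  assumes a: "a \<in> carrier \<Lambda>" and b: "b \<in> carrier \<Lambda>"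
  shows "a \<otimes>\<^bsub>\<Lambda>\<^esub> b = b \<otimes>\<^bsub>\<Lambda>\<^esub> a"
proof
  fix g
  let ?B = "{h. b h \<noteq> \<zero> \<and> a (g - h) \<noteq> \<zero>}"
  have inj: "inj_on (\<lambda>h. g - h) ?B" by (auto simp: inj_on_def)
  have "(a \<otimes>\<^bsub>\<Lambda>\<^esub> b) g = (\<Oplus>h\<in>(\<lambda>h. g - h) ` ?B. a h \<otimes> b (g - h))"
  proof (rule mult_eq[OF a b])
    show "finite ((\<lambda>h. g - h) ` ?B)" using finite_pairs[OF b a] by simp
    show "h \<in> (\<lambda>h. g - h) ` ?B" if "a h \<noteq> \<zero>" "b (g - h) \<noteq> \<zero>" for h
      using that by (intro image_eqI[of _ _ "g - h"]) auto
  qed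
  also have "\<dots> = (\<Oplus>h\<in>?B. a (g - h) \<otimes> b (g - (g - h)))"
    by (rule finsum_reindex[OF _ inj]) (use coeff_closed a b in auto)
  also have "\<dots> = (b \<otimes>\<^bsub>\<Lambda>\<^esub> a) g"
    unfolding novikov_mult by (rule finsum_cong') (use coeff_closed a b m_comm in auto)
  finally show "(a \<otimes>\<^bsub>\<Lambda>\<^esub> b) g = (b \<otimes>\<^bsub>\<Lambda>\<^esub> a) g" .
qed

lemma mult_distrib:
  assumes a: "a \<in> carrier \<Lambda>" and b: "b \<in> carrier \<Lambda>" and c: "c \<in> carrier \<Lambda>"
  shows "(a \<oplus>\<^bsub>\<Lambda>\<^esub> b) \<otimes>\<^bsub>\<Lambda>\<^esub> c = a \<otimes>\<^bsub>\<Lambda>\<^esub> c \<oplus>\<^bsub>\<Lambda>\<^esub> b \<otimes>\<^bsub>\<Lambda>\<^esub> c"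
proof
  fix g
  let ?A = "{h. a h \<noteq> \<zero> \<and> c (g - h) \<noteq> \<zero>} \<union> {h. b h \<noteq> \<zero> \<and> c (g - h) \<noteq> \<zero>}"
  have fin: "finite ?A" using finite_pairs a b c by simp
  note cl = coeff_closed[OF a] coeff_closed[OF b] coeff_closed[OF c]
  have "((a \<oplus>\<^bsub>\<Lambda>\<^esub> b) \<otimes>\<^bsub>\<Lambda>\<^esub> c) g = (\<Oplus>h\<in>?A. (a \<oplus>\<^bsub>\<Lambda>\<^esub> b) h \<otimes> c (g - h))"
  proof (rule mult_eq[OF add_closed[OF a b] c fin])
    fix h assume "(a \<oplus>\<^bsub>\<Lambda>\<^esub> b) h \<noteq> \<zero>" "c (g - h) \<noteq> \<zero>"
    thus "h \<in> ?A" unfolding novikov_simps by force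
  qed
  also have "\<dots> = (\<Oplus>h\<in>?A. a h \<otimes> c (g - h) \<oplus> b h \<otimes> c (g - h))"
    by (rule finsum_cong') (use cl in \<open>auto simp: novikov_simps l_distr\<close>)
  also have "\<dots> = (\<Oplus>h\<in>?A. a h \<otimes> c (g - h)) \<oplus> (\<Oplus>h\<in>?A. b h \<otimes> c (g - h))"
    by (rule finsum_addf) (use cl in auto)
  also have "(\<Oplus>h\<in>?A. a h \<otimes> c (g - h)) = (a \<otimes>\<^bsub>\<Lambda>\<^esub> c) g"
    by (rule mult_eq[OF a c fin, symmetric]) auto
  also have "(\<Oplus>h\<in>?A. b h \<otimes> c (g - h)) = (b \<otimes>\<^bsub>\<Lambda>\<^esub> c) g"
    by (rule mult_eq[OF b c fin, symmetric]) auto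
  finally show "((a \<oplus>\<^bsub>\<Lambda>\<^esub> b) \<otimes>\<^bsub>\<Lambda>\<^esub> c) g = (a \<otimes>\<^bsub>\<Lambda>\<^esub> c \<oplus>\<^bsub>\<Lambda>\<^esub> b \<otimes>\<^bsub>\<Lambda>\<^esub> c) g"
    unfolding novikov_simps .
qed

lemma mult_assoc:
  assumes a: "a \<in> carrier \<Lambda>" and b: "b \<in> carrier \<Lambda>" and c: "c \<in> carrier \<Lambda>"
  shows "(a \<otimes>\<^bsub>\<Lambda>\<^esub> b) \<otimes>\<^bsub>\<Lambda>\<^esub> c = a \<otimes>\<^bsub>\<Lambda>\<^esub> (b \<otimes>\<^bsub>\<Lambda>\<^esub> c)"
proof
  fix x
  note cl = coeff_closed[OF a] coeff_closed[OF b] coeff_closed[OF c]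
  note ab = mult_closed[OF a b] and bc = mult_closed[OF b c]
  obtain L where L: "\<And>g. a g \<noteq> \<zero> \<Longrightarrow> L \<le> g" using support_bounded_below[OF a] by blast
  obtain M where M: "\<And>g. b g \<noteq> \<zero> \<Longrightarrow> M \<le> g" using support_bounded_below[OF b] by blast
  obtain N where N: "\<And>g. c g \<noteq> \<zero> \<Longrightarrow> N \<le> g" using support_bounded_below[OF c] by blast
  define P where "P = {h. h < x - M - N + 1 \<and> a h \<noteq> \<zero>}"
  define Q where "Q = {h. h < x - L - N + 1 \<and> b h \<noteq> \<zero>}"
  define S where "S = (\<lambda>(p, q). p + q) ` (P \<times> Q)"
  have finP: "finite P" and finQ: "finite Q"
    unfolding P_def Q_def using coeff_finite a b by auto
  have finS: "finite S" unfolding S_def using finP finQ by simp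
  have S_I: "p + q \<in> S" if "p \<in> P" "q \<in> Q" for p q
    using that unfolding S_def by (force intro: image_eqI[of _ _ "(p, q)"])
  have "((a \<otimes>\<^bsub>\<Lambda>\<^esub> b) \<otimes>\<^bsub>\<Lambda>\<^esub> c) x = (\<Oplus>s\<in>S. (a \<otimes>\<^bsub>\<Lambda>\<^esub> b) s \<otimes> c (x - s))"
  proof (rule mult_eq[OF ab c finS])
    fix s assume s: "(a \<otimes>\<^bsub>\<Lambda>\<^esub> b) s \<noteq> \<zero>" "c (x - s) \<noteq> \<zero>"
    obtain p where p: "a p \<noteq> \<zero>" "b (s - p) \<noteq> \<zero>" using mult_nonzero_coeff[OF a b s(1)] .
    have "p \<in> P" "s - p \<in> Q"
      using L[OF p(1)] M[OF p(2)] N[OF s(2)] p unfolding P_def Q_def by auto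
    from S_I[OF this] show "s \<in> S" by simp
  qed
  also have "\<dots> = (\<Oplus>s\<in>S. \<Oplus>p\<in>P. a p \<otimes> b (s - p) \<otimes> c (x - s))"
  proof (rule finsum_cong'[OF refl])
    show "(\<lambda>s. \<Oplus>p\<in>P. a p \<otimes> b (s - p) \<otimes> c (x - s)) \<in> S \<rightarrow> carrier K"
      by (intro Pi_I finsum_closed) (use cl in auto)
    fix s
    show "(a \<otimes>\<^bsub>\<Lambda>\<^esub> b) s \<otimes> c (x - s) = (\<Oplus>p\<in>P. a p \<otimes> b (s - p) \<otimes> c (x - s))"
    proof (cases "c (x - s) = \<zero>")
      case True
      have "(\<Oplus>p\<in>P. a p \<otimes> b (s - p) \<otimes> c (x - s)) = \<zero>"
        by (rule add.finprod_one_eqI) (use True cl in auto)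
      thus ?thesis using True coeff_closed[OF ab] by simp
    next
      case False
      have "(a \<otimes>\<^bsub>\<Lambda>\<^esub> b) s = (\<Oplus>p\<in>P. a p \<otimes> b (s - p))"
      proof (rule mult_eq[OF a b finP])
        fix p assume p: "a p \<noteq> \<zero>" "b (s - p) \<noteq> \<zero>"
        show "p \<in> P" using M[OF p(2)] N[OF False] p unfolding P_def by auto
      qed
      thus ?thesis
        using finsum_ldistr[OF finP, of "c (x - s)" "\<lambda>p. a p \<otimes> b (s - p)"] cl by auto
    qed
  qed
  also have "\<dots> = (\<Oplus>p\<in>P. \<Oplus>s\<in>S. a p \<otimes> b (s - p) \<otimes> c (x - s))"
    by (rule finsum_finsum_swap[OF finS finP]) (use cl in auto)
  also have "\<dots> = (\<Oplus>p\<in>P. a p \<otimes> (b \<otimes>\<^bsub>\<Lambda>\<^esub> c) (x - p))"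
  proof (rule finsum_cong'[OF refl])
    show "(\<lambda>p. a p \<otimes> (b \<otimes>\<^bsub>\<Lambda>\<^esub> c) (x - p)) \<in> P \<rightarrow> carrier K"
      using cl coeff_closed[OF bc] by auto
    fix p assume p: "p \<in> P"
    have inj: "inj_on (\<lambda>s. s - p) S" by (auto simp: inj_on_def)
    have "(b \<otimes>\<^bsub>\<Lambda>\<^esub> c) (x - p) = (\<Oplus>q\<in>(\<lambda>s. s - p) ` S. b q \<otimes> c (x - p - q))"
    proof (rule mult_eq[OF b c])
      show "finite ((\<lambda>s. s - p) ` S)" using finS by simp
      fix q assume q: "b q \<noteq> \<zero>" "c (x - p - q) \<noteq> \<zero>"
      have "L \<le> p" using p L unfolding P_def by simp
      hence "q \<in> Q" using N[OF q(2)] q unfolding Q_def by auto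
      hence "p + q \<in> S" using S_I p by simp
      thus "q \<in> (\<lambda>s. s - p) ` S" by (intro image_eqI[of _ _ "p + q"]) auto
    qed
    also have "\<dots> = (\<Oplus>s\<in>S. b (s - p) \<otimes> c (x - p - (s - p)))"
      by (rule finsum_reindex[OF _ inj]) (use cl in auto)
    also have "\<dots> = (\<Oplus>s\<in>S. b (s - p) \<otimes> c (x - s))" by simp
    finally have "a p \<otimes> (b \<otimes>\<^bsub>\<Lambda>\<^esub> c) (x - p) = a p \<otimes> (\<Oplus>s\<in>S. b (s - p) \<otimes> c (x - s))"
      by simp
    also have "\<dots> = (\<Oplus>s\<in>S. a p \<otimes> (b (s - p) \<otimes> c (x - s)))"
      by (rule finsum_rdistr[OF finS]) (use cl in auto)
    also have "\<dots> = (\<Oplus>s\<in>S. a p \<otimes> b (s - p) \<otimes> c (x - s))"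
      by (rule finsum_cong') (use cl in \<open>auto simp: m_assoc\<close>)
    finally show "(\<Oplus>s\<in>S. a p \<otimes> b (s - p) \<otimes> c (x - s)) = a p \<otimes> (b \<otimes>\<^bsub>\<Lambda>\<^esub> c) (x - p)" ..
  qed
  also have "\<dots> = (a \<otimes>\<^bsub>\<Lambda>\<^esub> (b \<otimes>\<^bsub>\<Lambda>\<^esub> c)) x"
  proof (rule mult_eq[OF a bc finP, symmetric])
    fix p assume p: "a p \<noteq> \<zero>" "(b \<otimes>\<^bsub>\<Lambda>\<^esub> c) (x - p) \<noteq> \<zero>"
    obtain q where q: "b q \<noteq> \<zero>" "c (x - p - q) \<noteq> \<zero>" using mult_nonzero_coeff[OF b c p(2)] .
    show "p \<in> P" using M[OF q(1)] N[OF q(2)] p unfolding P_def by auto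
  qed
  finally show "((a \<otimes>\<^bsub>\<Lambda>\<^esub> b) \<otimes>\<^bsub>\<Lambda>\<^esub> c) x = (a \<otimes>\<^bsub>\<Lambda>\<^esub> (b \<otimes>\<^bsub>\<Lambda>\<^esub> c)) x" .
qed

lemma monomial_mult:
  assumes t: "t \<in> \<Gamma>" and a: "a \<in> carrier \<Lambda>"
  shows "((\<lambda>g. if g = t then \<one> else \<zero>) \<otimes>\<^bsub>\<Lambda>\<^esub> a) g = a (g - t)"
proof -
  have "((\<lambda>g. if g = t then \<one> else \<zero>) \<otimes>\<^bsub>\<Lambda>\<^esub> a) g
    = (\<Oplus>h\<in>{t}. (if h = t then \<one> else \<zero>) \<otimes> a (g - h))"
    by (rule mult_eq[OF monomial_closed[OF t] a]) (auto split: if_splits)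
  thus ?thesis using coeff_closed[OF a] by simp
qed

lemma one_novikov: "\<one>\<^bsub>\<Lambda>\<^esub> = (\<lambda>g. if g = 0 then \<one> else \<zero>)"
  by (simp add: novikov_ring_def)

lemma cring_novikov: "cring \<Lambda>"
proof (rule cringI)
  show "abelian_group \<Lambda>"
  proof (rule abelian_groupI)
    fix a assume a: "a \<in> carrier \<Lambda>"
    have "(\<lambda>g. \<ominus> a g) \<oplus>\<^bsub>\<Lambda>\<^esub> a = \<zero>\<^bsub>\<Lambda>\<^esub>"
      using coeff_closed[OF a] by (auto simp: novikov_simps l_neg)
    thus "\<exists>b\<in>carrier \<Lambda>. b \<oplus>\<^bsub>\<Lambda>\<^esub> a = \<zero>\<^bsub>\<Lambda>\<^esub>" using uminus_closed[OF a] by blast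
  qed (use coeff_closed in \<open>auto simp: add_closed zero_novikov_closed novikov_simps fun_eq_iff a_ac\<close>)
  show "Group.comm_monoid \<Lambda>"
  proof (rule comm_monoidI)
    show "\<one>\<^bsub>\<Lambda>\<^esub> \<in> carrier \<Lambda>" unfolding one_novikov by (rule monomial_closed[OF zero_Gamma])
    show "\<one>\<^bsub>\<Lambda>\<^esub> \<otimes>\<^bsub>\<Lambda>\<^esub> a = a" if "a \<in> carrier \<Lambda>" for a
      using monomial_mult[OF zero_Gamma that] by (auto simp: one_novikov)
  qed (rule mult_closed mult_assoc mult_comm; assumption)+
qed (rule mult_distrib)

text \<open>
  An inverse of an element with minimal exponent 0 is constructed by recursion on the
  exponent: the equation for the coefficient at \<open>s\<close> determines it from the coefficients at
  \<open>s - h\<close>, where \<open>h\<close> is a positive exponent and hence bounded away from 0.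
\<close>

lemma inverse_normalized:
  assumes a: "a \<in> carrier \<Lambda>" and a0: "a 0 \<noteq> \<zero>" and amin: "\<And>g. a g \<noteq> \<zero> \<Longrightarrow> 0 \<le> g"
  obtains b where "b \<in> carrier \<Lambda>" "a \<otimes>\<^bsub>\<Lambda>\<^esub> b = \<one>\<^bsub>\<Lambda>\<^esub>"
proof -
  note cl = coeff_closed[OF a]
  obtain e where e: "e > 0" and eps: "\<And>g. a g \<noteq> \<zero> \<Longrightarrow> 0 < g \<Longrightarrow> e \<le> g"
  proof -
    let ?S = "{g. 0 < g \<and> g < 1 \<and> a g \<noteq> \<zero>}"
    have fin: "finite (insert 1 ?S)"
      using coeff_finite[OF a, of 1] by (auto intro: finite_subset)
    show ?thesis
    proof (rule that[of "Min (insert 1 ?S)"])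
      show "0 < Min (insert 1 ?S)" using fin by (subst Min_gr_iff) auto
      show "Min (insert 1 ?S) \<le> g" if "a g \<noteq> \<zero>" "0 < g" for g
      proof (cases "g < 1")
        case True thus ?thesis using that fin by (intro Min_le) auto
      next
        case False
        have "Min (insert 1 ?S) \<le> 1" using fin by (intro Min_le) auto
        thus ?thesis using False by simp
      qed
    qed
  qed
  define I where "I s = {h. a h \<noteq> \<zero> \<and> 0 < h \<and> h \<le> s}" for s
  have finI: "finite (I s)" for s
    unfolding I_def by (rule finite_subset[OF _ coeff_finite[OF a, of "s + 1"]]) auto
  have cU: "a 0 \<in> Units K" using cl a0 field_Units by auto
  define F where "F b s = (if s < 0 then \<zero> else
      inv (a 0) \<otimes> ((if s = 0 then \<one> else \<zero>) \<ominus>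
        (\<Oplus>h\<in>I s. a h \<otimes> (if h \<in> I s then b (s - h) else \<zero>))))" for b s
  define m where "m s = nat \<lfloor>s / e\<rfloor>" for s
  have m_less: "m (s - h) < m s" if "h \<in> I s" for s h
  proof -
    have h: "e \<le> h" "h \<le> s" using that eps unfolding I_def by auto
    have "(s - h) / e \<le> s / e - 1" using h e by (simp add: field_simps)
    moreover have "0 \<le> (s - h) / e" using h e by simp
    ultimately show ?thesis unfolding m_def by linarith
  qed
  define b where "b = wfrec (measure m) F"
  have "adm_wf (measure m) F"
    unfolding adm_wf_def
  proof (intro allI impI)
    fix f g :: "real \<Rightarrow> 'k" and x
    assume "\<forall>z. (z, x) \<in> measure m \<longrightarrow> f z = g z"
    hence fg: "f (x - h) = g (x - h)" if "h \<in> I x" for h using m_less[OF that] by simp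
    hence "(\<lambda>h. if h \<in> I x then f (x - h) else \<zero>) = (\<lambda>h. if h \<in> I x then g (x - h) else \<zero>)"
      by auto
    from fun_cong[OF this] have "(if h \<in> I x then f (x - h) else \<zero>) =
      (if h \<in> I x then g (x - h) else \<zero>)" for h .
    thus "F f x = F g x" unfolding F_def by simp
  qed
  from wfrec_fixpoint[OF wf_measure this] have "b = F b" unfolding b_def .
  hence b: "b s = F b s" for s by metis
  have bneg: "s \<ge> 0" if "b s \<noteq> \<zero>" for s using that b[of s] unfolding F_def by (auto split: if_splits)
  have bcl: "b s \<in> carrier K" for s
  proof (induction s rule: measure_induct_rule[of m])
    case (less s)
    have "(\<Oplus>h\<in>I s. a h \<otimes> (if h \<in> I s then b (s - h) else \<zero>)) \<in> carrier K"
      by (rule finsum_closed) (use less m_less cl in auto)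
    thus ?case using b[of s] cU unfolding F_def by (auto simp: a_minus_def)
  qed
  have bstep: "s = 0 \<or> (\<exists>h\<in>I s. b (s - h) \<noteq> \<zero>)" if "b s \<noteq> \<zero>" for s
  proof (rule ccontr)
    assume "\<not> ?thesis"
    hence s: "s \<noteq> 0" and z: "\<And>h. h \<in> I s \<Longrightarrow> b (s - h) = \<zero>" by auto
    have "(\<Oplus>h\<in>I s. a h \<otimes> (if h \<in> I s then b (s - h) else \<zero>)) = \<zero>"
      by (rule add.finprod_one_eqI) (use z cl in auto)
    hence "b s = \<zero>" using b[of s] s cU unfolding F_def by (auto simp: a_minus_def)
    thus False using that by simp
  qed
  have bG: "s \<in> \<Gamma>" if "b s \<noteq> \<zero>" for s
    using that
  proof (induction s rule: measure_induct_rule[of m])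
    case (less s)
    show ?case
    proof (cases "s = 0")
      case True thus ?thesis using zero_Gamma by simp
    next
      case False
      then obtain h where h: "h \<in> I s" "b (s - h) \<noteq> \<zero>" using bstep[OF less.prems] by blast
      have "s - h \<in> \<Gamma>" using less.IH[OF m_less[OF h(1)] h(2)] .
      moreover have "h \<in> \<Gamma>" using h(1) coeff_Gamma[OF a] unfolding I_def by auto
      ultimately have "h + (s - h) \<in> \<Gamma>" using add_Gamma by blast
      thus ?thesis by simp
    qed
  qed
  have bfin_nat: "finite {s. s < real n * e \<and> b s \<noteq> \<zero>}" for n
  proof (induction n)
    case 0
    have "{s. s < real 0 * e \<and> b s \<noteq> \<zero>} = {}" using bneg by force
    thus ?case by (simp only: finite.emptyI)
  next
    case (Suc n)
    let ?A = "{h. h < real (Suc n) * e \<and> a h \<noteq> \<zero>}" and ?B = "{s. s < real n * e \<and> b s \<noteq> \<zero>}"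
    have "{s. s < real (Suc n) * e \<and> b s \<noteq> \<zero>} \<subseteq> insert 0 ((\<lambda>(x, y). x + y) ` (?A \<times> ?B))"
    proof
      fix s assume "s \<in> {s. s < real (Suc n) * e \<and> b s \<noteq> \<zero>}"
      hence s: "s < real (Suc n) * e" "b s \<noteq> \<zero>" by auto
      show "s \<in> insert 0 ((\<lambda>(x, y). x + y) ` (?A \<times> ?B))"
      proof (cases "s = 0")
        case False
        then obtain h where h: "h \<in> I s" "b (s - h) \<noteq> \<zero>" using bstep[OF s(2)] by blast
        have "e \<le> h" "h \<le> s" "a h \<noteq> \<zero>" using h(1) eps unfolding I_def by auto
        hence "(h, s - h) \<in> ?A \<times> ?B" using h(2) s(1) by (auto simp: algebra_simps)
        moreover have "s = (\<lambda>(x, y). x + y) (h, s - h)" by simp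
        ultimately show ?thesis by blast
      qed simp
    qed
    thus ?case by (rule finite_subset) (use Suc coeff_finite[OF a] in auto)
  qed
  have bL: "b \<in> carrier \<Lambda>"
    unfolding carrier_iff
  proof (intro conjI allI impI bcl bG)
    fix C
    obtain n where "C / e < real n" using reals_Archimedean2 by blast
    hence "C < real n * e" using e by (simp add: field_simps)
    hence "{g. g < C \<and> b g \<noteq> \<zero>} \<subseteq> {s. s < real n * e \<and> b s \<noteq> \<zero>}" by auto
    thus "finite {g. g < C \<and> b g \<noteq> \<zero>}" using bfin_nat finite_subset by blast
  qed auto
  have "a \<otimes>\<^bsub>\<Lambda>\<^esub> b = \<one>\<^bsub>\<Lambda>\<^esub>"
  proof
    fix s
    show "(a \<otimes>\<^bsub>\<Lambda>\<^esub> b) s = \<one>\<^bsub>\<Lambda>\<^esub> s"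
    proof (cases "s < 0")
      case True
      have "(a \<otimes>\<^bsub>\<Lambda>\<^esub> b) s = \<zero>"
      proof (rule ccontr)
        assume "(a \<otimes>\<^bsub>\<Lambda>\<^esub> b) s \<noteq> \<zero>"
        then obtain h where "a h \<noteq> \<zero>" "b (s - h) \<noteq> \<zero>" using mult_nonzero_coeff[OF a bL] by blast
        thus False using amin[of h] bneg[of "s - h"] True by simp
      qed
      thus ?thesis using True by (simp add: novikov_simps)
    next
      case False
      let ?d = "if s = 0 then \<one> else \<zero>" and ?\<Sigma> = "\<Oplus>h\<in>I s. a h \<otimes> b (s - h)"
      have eq: "(\<Oplus>h\<in>I s. a h \<otimes> (if h \<in> I s then b (s - h) else \<zero>)) = ?\<Sigma>"
        by (rule finsum_cong') (use cl bcl in auto)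
      have \<Sigma>: "?\<Sigma> \<in> carrier K" by (rule finsum_closed) (use cl bcl in auto)
      have "(a \<otimes>\<^bsub>\<Lambda>\<^esub> b) s = (\<Oplus>h\<in>insert 0 (I s). a h \<otimes> b (s - h))"
      proof (rule mult_eq[OF a bL])
        fix h assume h: "a h \<noteq> \<zero>" "b (s - h) \<noteq> \<zero>"
        show "h \<in> insert 0 (I s)" using amin[OF h(1)] bneg[OF h(2)] h unfolding I_def by auto
      qed (simp add: finI)
      also have "\<dots> = a 0 \<otimes> b (s - 0) \<oplus> ?\<Sigma>"
        by (rule finsum_insert) (use finI cl bcl in \<open>auto simp: I_def\<close>)
      also have "a 0 \<otimes> b (s - 0) = a 0 \<otimes> (inv (a 0) \<otimes> (?d \<ominus> ?\<Sigma>))"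
        using b[of s] False unfolding F_def eq by simp
      also have "\<dots> = ?d \<ominus> ?\<Sigma>"
        using cU \<Sigma> cl by (simp add: m_assoc[symmetric])
      also have "?d \<ominus> ?\<Sigma> \<oplus> ?\<Sigma> = ?d"
        using \<Sigma> by (simp add: a_minus_def a_assoc l_neg)
      finally show ?thesis by (simp add: novikov_simps)
    qed
  qed
  thus ?thesis using that bL by blast
qed

theorem field_novikov: "field \<Lambda>"
proof -
  interpret N: cring \<Lambda> by (rule cring_novikov)
  show ?thesis
  proof (rule N.cring_fieldI2)
    show "\<zero>\<^bsub>\<Lambda>\<^esub> \<noteq> \<one>\<^bsub>\<Lambda>\<^esub>"
    proof
      assume "\<zero>\<^bsub>\<Lambda>\<^esub> = \<one>\<^bsub>\<Lambda>\<^esub>"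
      from fun_cong[OF this, of 0] show False by (simp add: novikov_simps)
    qed
    fix a assume a: "a \<in> carrier \<Lambda>" and "a \<noteq> \<zero>\<^bsub>\<Lambda>\<^esub>"
    then obtain g1 where "a g1 \<noteq> \<zero>" by (auto simp: fun_eq_iff novikov_simps)
    then obtain g0 where g0: "a g0 \<noteq> \<zero>" and g0_le: "\<And>g. a g \<noteq> \<zero> \<Longrightarrow> g0 \<le> g"
      using support_Min[OF a] by blast
    have t: "- g0 \<in> \<Gamma>" using coeff_Gamma[OF a g0] uminus_Gamma by blast
    define T where "T = (\<lambda>g. if g = - g0 then \<one> else \<zero>)"
    have T: "T \<in> carrier \<Lambda>" unfolding T_def by (rule monomial_closed[OF t])
    have Ta: "(T \<otimes>\<^bsub>\<Lambda>\<^esub> a) g = a (g + g0)" for g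
      unfolding T_def using monomial_mult[OF t a] by simp
    obtain b where b: "b \<in> carrier \<Lambda>" "(T \<otimes>\<^bsub>\<Lambda>\<^esub> a) \<otimes>\<^bsub>\<Lambda>\<^esub> b = \<one>\<^bsub>\<Lambda>\<^esub>"
    proof (rule inverse_normalized[of "T \<otimes>\<^bsub>\<Lambda>\<^esub> a"])
      show "T \<otimes>\<^bsub>\<Lambda>\<^esub> a \<in> carrier \<Lambda>" using T a by simp
      show "(T \<otimes>\<^bsub>\<Lambda>\<^esub> a) 0 \<noteq> \<zero>" using g0 by (simp add: Ta)
      show "0 \<le> g" if "(T \<otimes>\<^bsub>\<Lambda>\<^esub> a) g \<noteq> \<zero>" for g using that g0_le[of "g + g0"] by (simp add: Ta)
    qed
    have "a \<otimes>\<^bsub>\<Lambda>\<^esub> (T \<otimes>\<^bsub>\<Lambda>\<^esub> b) = (T \<otimes>\<^bsub>\<Lambda>\<^esub> a) \<otimes>\<^bsub>\<Lambda>\<^esub> b"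
      using N.m_assoc[OF T a b(1)] N.m_lcomm[OF T a b(1)] by simp
    hence "a \<otimes>\<^bsub>\<Lambda>\<^esub> (T \<otimes>\<^bsub>\<Lambda>\<^esub> b) = \<one>\<^bsub>\<Lambda>\<^esub>" using b(2) by simp
    thus "\<exists>b\<in>carrier \<Lambda>. a \<otimes>\<^bsub>\<Lambda>\<^esub> b = \<one>\<^bsub>\<Lambda>\<^esub>" using N.m_closed[OF T b(1)] by blast
  qed
qed

end


section \<open>Orthogonalizable spaces\<close>

text \<open>
  Values of the filtration function are extended reals; \<open>l_less_top\<close> restricts them to
  the reals together with \<open>-\<infinity>\<close>. The subtraction in \<open>l_smult\<close> is never \<open>\<infinity> - \<infinity>\<close>:
  it yields \<open>-\<infinity>\<close> as soon as the scalar or the vector is zero.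
\<close>

locale nonarch_normed_space =
  vectorspace "novikov_ring K \<Gamma>" V
  for K :: "('k, 'm) ring_scheme" and \<Gamma> :: "real set"
    and V :: "(real \<Rightarrow> 'k, 'v, 'n) module_scheme" +
  fixes l :: "'v \<Rightarrow> ereal"
  assumes l_less_top: "x \<in> carrier V \<Longrightarrow> l x < \<infinity>"
    and l_eq_bot_iff: "x \<in> carrier V \<Longrightarrow> l x = -\<infinity> \<longleftrightarrow> x = \<zero>\<^bsub>V\<^esub>"
    and l_smult: "\<lbrakk>c \<in> carrier (novikov_ring K \<Gamma>); x \<in> carrier V\<rbrakk>
      \<Longrightarrow> l (c \<odot>\<^bsub>V\<^esub> x) = l x - novikov_val K c"
    and l_add: "\<lbrakk>x \<in> carrier V; y \<in> carrier V\<rbrakk> \<Longrightarrow> l (x \<oplus>\<^bsub>V\<^esub> y) \<le> max (l x) (l y)"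

text \<open>
  The element \<open>-\<infinity>\<close> inserted in the maximum only matters for the empty collection,
  where the sum is zero and the condition reads \<open>l 0 = -\<infinity>\<close>.
\<close>

definition orthogonal_list ::
  "('k, 'm) ring_scheme \<Rightarrow> real set \<Rightarrow> (real \<Rightarrow> 'k, 'v, 'n) module_scheme
    \<Rightarrow> ('v \<Rightarrow> ereal) \<Rightarrow> 'v list \<Rightarrow> bool" where
  "orthogonal_list K \<Gamma> V l ws \<longleftrightarrow>
    set ws \<subseteq> carrier V \<and>
    (\<forall>c \<in> {..<length ws} \<rightarrow> carrier (novikov_ring K \<Gamma>).
      l (\<Oplus>\<^bsub>V\<^esub>i\<in>{..<length ws}. c i \<odot>\<^bsub>V\<^esub> ws ! i)
        = Max (insert (-\<infinity>) ((\<lambda>i. l (c i \<odot>\<^bsub>V\<^esub> ws ! i)) ` {..<length ws})))"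

definition orthogonal_basis ::
  "('k, 'm) ring_scheme \<Rightarrow> real set \<Rightarrow> (real \<Rightarrow> 'k, 'v, 'n) module_scheme
    \<Rightarrow> ('v \<Rightarrow> ereal) \<Rightarrow> 'v list \<Rightarrow> bool" where
  "orthogonal_basis K \<Gamma> V l ws \<longleftrightarrow>
    distinct ws \<and> vectorspace.basis (novikov_ring K \<Gamma>) V (set ws) \<and>
    orthogonal_list K \<Gamma> V l ws"

definition orthogonalizable_space ::
  "('k, 'm) ring_scheme \<Rightarrow> real set \<Rightarrow> (real \<Rightarrow> 'k, 'v, 'n) module_scheme
    \<Rightarrow> ('v \<Rightarrow> ereal) \<Rightarrow> bool" where
  "orthogonalizable_space K \<Gamma> V l \<longleftrightarrow>
    nonarch_normed_space K \<Gamma> V l \<and>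
    vectorspace.fin_dim (novikov_ring K \<Gamma>) V \<and>
    (\<exists>ws. orthogonal_basis K \<Gamma> V l ws)"


section \<open>Singular value decompositions\<close>

definition rank ::
  "('s, 'm) ring_scheme \<Rightarrow> ('s, 'c, 'p) module_scheme \<Rightarrow> ('s, 'd, 'q) module_scheme
    \<Rightarrow> ('c \<Rightarrow> 'd) \<Rightarrow> nat" where
  "rank \<Lambda> C D A = vectorspace.dim \<Lambda> (D\<lparr>carrier := mod_hom.im C A\<rparr>)"

text \<open>Lists are indexed from 0, so the index \<open>i\<close> here is \<open>i + 1\<close> in the usual numbering.\<close>

definition singular_value_decomposition ::
  "('k, 'm) ring_scheme \<Rightarrow> real set
    \<Rightarrow> (real \<Rightarrow> 'k, 'c, 'p) module_scheme \<Rightarrow> ('c \<Rightarrow> ereal)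
    \<Rightarrow> (real \<Rightarrow> 'k, 'd, 'q) module_scheme \<Rightarrow> ('d \<Rightarrow> ereal)
    \<Rightarrow> ('c \<Rightarrow> 'd) \<Rightarrow> 'c list \<Rightarrow> 'd list \<Rightarrow> bool" where
  "singular_value_decomposition K \<Gamma> C lC D lD A ys xs \<longleftrightarrow>
    (let r = rank (novikov_ring K \<Gamma>) C D A in
      orthogonal_basis K \<Gamma> C lC ys \<and>
      orthogonal_basis K \<Gamma> D lD xs \<and>
      orthogonal_basis K \<Gamma> (C\<lparr>carrier := mod_hom.ker C D A\<rparr>) lC (drop r ys) \<and>
      orthogonal_basis K \<Gamma> (D\<lparr>carrier := mod_hom.im C A\<rparr>) lD (take r xs) \<and>
      (\<forall>i<r. A (ys ! i) = xs ! i) \<and>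
      (\<forall>i. Suc i < r \<longrightarrow>
        lC (ys ! i) - lD (xs ! i) \<ge> lC (ys ! Suc i) - lD (xs ! Suc i)))"

end

theory Submission
  imports Defs
begin

text \<open>
  Gaussian elimination with a pivot of maximal gain. Among the vectors of an orthogonal basis of
  \<open>C\<close> choose \<open>y\<close> maximizing \<open>lD (A y) - lC y\<close>. If \<open>x = A y\<close> is nonzero, it can replace a
  basis vector \<open>e\<close> of \<open>D\<close> whose term in the expansion of \<open>x\<close> has the largest filtration level.
  Subtracting multiples of \<open>y\<close> from the other basis vectors of \<open>C\<close> makes \<open>A\<close> map them into the span
  of the rest of the basis of \<open>D\<close>; by maximality of the gain these multiples do not exceed the
  vectors they are subtracted from, so the basis stays orthogonal. Induction
  applies to the two complements, and it remains to sort the pivots.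
\<close>

section \<open>Preliminaries: finite maxima, spans in vector spaces, spans of images\<close>

lemma finite_ex_max:
  fixes f :: "'a \<Rightarrow> 'b::linorder"
  assumes "finite A" "A \<noteq> {}"
  obtains x where "x \<in> A" "\<And>y. y \<in> A \<Longrightarrow> f y \<le> f x"
proof -
  obtain x where "x \<in> A" "f x = Max (f ` A)" using Max_in[of "f ` A"] assms by fastforce
  thus ?thesis using that[of x] assms(1) by simp
qed

context vectorspace
begin

lemma smult_eq_zero_iff:
  assumes "c \<in> carrier K" "x \<in> carrier V"
  shows "c \<odot>\<^bsub>V\<^esub> x = \<zero>\<^bsub>V\<^esub> \<longleftrightarrow> c = \<zero>\<^bsub>K\<^esub> \<or> x = \<zero>\<^bsub>V\<^esub>"
  using mult_inverse[OF assms, of "\<zero>\<^bsub>V\<^esub>"] assms by (auto simp: field_Units)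

lemma span_smult:
  assumes "B \<subseteq> carrier V" "c \<in> carrier K" "v \<in> span B"
  shows "c \<odot>\<^bsub>V\<^esub> v \<in> span B"
  using span_is_submodule[OF assms(1)] assms(2,3) by (rule submodule.smult_closed)

lemma span_subsetI:
  assumes "B \<subseteq> carrier V" "A \<subseteq> span B"
  shows "span A \<subseteq> span B"
  using span_is_subset[OF assms(2) span_is_submodule[OF assms(1)]] .

lemma span_insertE:
  assumes fin: "finite B" and B: "B \<subseteq> carrier V" and x: "x \<in> carrier V"
    and v: "v \<in> span (insert x B)"
  obtains t w where "t \<in> carrier K" "w \<in> span B" "v = t \<odot>\<^bsub>V\<^esub> x \<oplus>\<^bsub>V\<^esub> w"
proof (cases "x \<in> B")
  case True
  hence "v \<in> span B" using v by (simp add: insert_absorb)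
  thus ?thesis using that[of "\<zero>\<^bsub>K\<^esub>" v] x B by simp
next
  case False
  obtain a where a: "a \<in> insert x B \<rightarrow> carrier K" "lincomb a (insert x B) = v"
    using finite_in_span[of "insert x B" v] fin B x v by auto
  have "lincomb a B \<in> span B" using fin a(1) unfolding span_def by auto
  thus ?thesis using that[of "a x"] a lincomb_insert2[OF fin B a(1) False x] by auto
qed

lemma span_insertI:
  assumes "B \<subseteq> carrier V" "x \<in> carrier V" "t \<in> carrier K" "w \<in> span B"
  shows "t \<odot>\<^bsub>V\<^esub> x \<oplus>\<^bsub>V\<^esub> w \<in> span (insert x B)"
  using assms span_is_monotone[of B "insert x B"]
  by (intro span_add1 span_smult) (auto intro: span_mem)

lemma add_minus_cancel:
  assumes "x \<in> carrier V" "y \<in> carrier V"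
  shows "(x \<oplus>\<^bsub>V\<^esub> y) \<oplus>\<^bsub>V\<^esub> \<ominus>\<^bsub>V\<^esub> x = y"
  using assms by (simp add: M.a_comm[of x y] M.a_assoc M.r_neg)

end

text \<open>Induction on the spanning set, peeling off one vector at a time. It serves to compute
  the image of the map from a spanning set of its domain.\<close>

lemma (in linear_map) image_span:
  assumes "finite B" "B \<subseteq> carrier V"
  shows "T ` V.module.span B = W.module.span (T ` B)"
  using assms
proof (induction B rule: finite_induct)
  case empty
  thus ?case by (simp add: V.span_empty W.span_empty)
next
  case (insert x B)
  hence B: "B \<subseteq> carrier V" and x: "x \<in> carrier V" and IH: "T ` V.module.span B = W.module.span (T ` B)"
    and TB: "T ` B \<subseteq> carrier W" and Tx: "T x \<in> carrier W" by auto
  have "T v \<in> W.module.span (insert (T x) (T ` B))" if v: "v \<in> V.module.span (insert x B)" for v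
  proof -
    obtain t w where tw: "t \<in> carrier K" "w \<in> V.module.span B" "v = t \<odot>\<^bsub>V\<^esub> x \<oplus>\<^bsub>V\<^esub> w"
      using V.span_insertE[OF insert.hyps(1) B x v] .
    have "T v = t \<odot>\<^bsub>W\<^esub> T x \<oplus>\<^bsub>W\<^esub> T w" using tw x V.span_closed[OF B tw(2)] by simp
    thus ?thesis using W.span_insertI[OF TB Tx tw(1), of "T w"] tw(2) IH by auto
  qed
  moreover have "u \<in> T ` V.module.span (insert x B)" if u: "u \<in> W.module.span (insert (T x) (T ` B))" for u
  proof -
    obtain t w' where tw: "t \<in> carrier K" "w' \<in> W.module.span (T ` B)" "u = t \<odot>\<^bsub>W\<^esub> T x \<oplus>\<^bsub>W\<^esub> w'"
      using W.span_insertE[OF _ TB Tx u] insert.hyps(1) by blast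
    obtain w where w: "w \<in> V.module.span B" "w' = T w" using tw(2) IH by blast
    have "u = T (t \<odot>\<^bsub>V\<^esub> x \<oplus>\<^bsub>V\<^esub> w)" using tw x w V.span_closed[OF B w(1)] by simp
    thus ?thesis using V.span_insertI[OF B x tw(1) w(1)] by blast
  qed
  ultimately show ?case by auto
qed

section \<open>Filtration levels and orthogonal sets in a normed space\<close>

context nonarch_normed_space
begin

abbreviation \<Lambda> where "\<Lambda> \<equiv> novikov_ring K \<Gamma>"

lemma l_zero: "l \<zero>\<^bsub>V\<^esub> = -\<infinity>"
  using l_eq_bot_iff by simp

lemma l_finite: "x \<in> carrier V \<Longrightarrow> x \<noteq> \<zero>\<^bsub>V\<^esub> \<Longrightarrow> \<bar>l x\<bar> \<noteq> \<infinity>"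
  using l_less_top[of x] l_eq_bot_iff[of x] by auto

text \<open>Negation shifts the level of every nonzero vector by the same constant, the valuation of
  -1. Negating twice is the identity, so twice this constant is zero.\<close>

lemma l_uminus:
  assumes x: "x \<in> carrier V"
  shows "l (\<ominus>\<^bsub>V\<^esub> x) = l x"
proof (cases "x = \<zero>\<^bsub>V\<^esub>")
  case False
  let ?m = "novikov_val K (\<ominus>\<^bsub>\<Lambda>\<^esub> \<one>\<^bsub>\<Lambda>\<^esub>)"
  have neg: "l (\<ominus>\<^bsub>V\<^esub> y) = l y - ?m" if "y \<in> carrier V" for y
    using l_smult[of "\<ominus>\<^bsub>\<Lambda>\<^esub> \<one>\<^bsub>\<Lambda>\<^esub>" y] that by (simp add: smult_minus_1)
  have "\<ominus>\<^bsub>V\<^esub> x \<noteq> \<zero>\<^bsub>V\<^esub>" using M.minus_nonzero[OF x False] .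
  from l_finite[OF _ this] l_finite[OF x False] neg[OF x] neg[of "\<ominus>\<^bsub>V\<^esub> x"] x
  show ?thesis by (cases "l x"; cases ?m; cases "l (\<ominus>\<^bsub>V\<^esub> x)") auto
next
  case True
  have "\<ominus>\<^bsub>V\<^esub> \<zero>\<^bsub>V\<^esub> = \<zero>\<^bsub>V\<^esub>" by (rule M.minus_equality) simp_all
  thus ?thesis by (simp only: True)
qed

lemma l_smult_mono:
  assumes "c \<in> carrier \<Lambda>" "x \<in> carrier V" "y \<in> carrier V" "l x \<le> l y"
  shows "l (c \<odot>\<^bsub>V\<^esub> x) \<le> l (c \<odot>\<^bsub>V\<^esub> y)"
  using assms by (simp add: l_smult ereal_minus_mono)

text \<open>Apply the strong triangle inequality to \<open>y = (x + y) - x\<close>.\<close>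

lemma l_right_summand_le:
  assumes x: "x \<in> carrier V" and y: "y \<in> carrier V" and le: "l x \<le> l (x \<oplus>\<^bsub>V\<^esub> y)"
  shows "l y \<le> l (x \<oplus>\<^bsub>V\<^esub> y)"
  using l_add[of "x \<oplus>\<^bsub>V\<^esub> y" "\<ominus>\<^bsub>V\<^esub> x"] assms by (simp add: add_minus_cancel l_uminus)

lemma l_lincomb_le:
  assumes "finite B" "B \<subseteq> carrier V" "a \<in> B \<rightarrow> carrier \<Lambda>"
    and "\<And>v. v \<in> B \<Longrightarrow> l (a v \<odot>\<^bsub>V\<^esub> v) \<le> m"
  shows "l (lincomb a B) \<le> m"
  using assms
proof (induction B rule: finite_induct)
  case (insert x B)
  have "l (lincomb a (insert x B)) \<le> max (l (a x \<odot>\<^bsub>V\<^esub> x)) (l (lincomb a B))"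
    using insert by (subst lincomb_insert2) (auto intro!: l_add)
  thus ?case using insert by (auto intro: order_trans)
qed (simp add: l_zero)

text \<open>Orthogonality for finite sets, where exchanging single vectors is easier than in lists.
  One inequality is enough, because \<open>l_lincomb_le\<close> supplies the other. Excluding the
  zero vector makes such sets linearly independent.\<close>

definition orthogonal_set :: "'v set \<Rightarrow> bool" where
  "orthogonal_set B \<longleftrightarrow> finite B \<and> B \<subseteq> carrier V - {\<zero>\<^bsub>V\<^esub>} \<and>
    (\<forall>a \<in> B \<rightarrow> carrier \<Lambda>. \<forall>v\<in>B. l (a v \<odot>\<^bsub>V\<^esub> v) \<le> l (lincomb a B))"

lemma orthogonal_setD:
  assumes "orthogonal_set B"
  shows "finite B" "B \<subseteq> carrier V" "\<zero>\<^bsub>V\<^esub> \<notin> B"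
    and "\<lbrakk>a \<in> B \<rightarrow> carrier \<Lambda>; v \<in> B\<rbrakk> \<Longrightarrow> l (a v \<odot>\<^bsub>V\<^esub> v) \<le> l (lincomb a B)"
  using assms unfolding orthogonal_set_def by auto

text \<open>A combination over the subset is one over the whole set once its coefficients are
  extended by zero, which is what \<open>emb\<close> does.\<close>

lemma orthogonal_set_subset:
  assumes B: "orthogonal_set B" and sub: "B' \<subseteq> B"
  shows "orthogonal_set B'"
  unfolding orthogonal_set_def
proof (intro conjI ballI)
  note o = orthogonal_setD[OF B]
  show fin: "finite B'" and "B' \<subseteq> carrier V - {\<zero>\<^bsub>V\<^esub>}" using o sub finite_subset by auto
  fix a v assume a: "a \<in> B' \<rightarrow> carrier \<Lambda>" and v: "v \<in> B'"
  let ?a = "emb a B'"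
  have "lincomb ?a (B' \<union> (B - B')) = lincomb ?a B'"
    by (rule lincomb_clean) (use o sub fin a in \<open>auto simp: emb_def\<close>)
  also have "\<dots> = lincomb a B'"
    by (rule lincomb_cong) (use o sub a in \<open>auto simp: emb_def\<close>)
  also have "B' \<union> (B - B') = B" using sub by auto
  finally have "lincomb ?a B = lincomb a B'" .
  moreover have "?a \<in> B \<rightarrow> carrier \<Lambda>" using a by (auto simp: emb_def)
  moreover have "?a v = a v" using v by (simp add: emb_def)
  ultimately show "l (a v \<odot>\<^bsub>V\<^esub> v) \<le> l (lincomb a B')" using o(4)[of ?a v] v sub by auto
qed

text \<open>If a combination vanishes, its level -\<infinity> bounds the level of each term, so each
  term is zero.\<close>

lemma orthogonal_set_lin_indpt:
  assumes B: "orthogonal_set B"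
  shows "lin_indpt B"
proof (rule finite_lin_indpt2[OF orthogonal_setD(1,2)[OF B]], intro ballI)
  fix a v assume a: "a \<in> B \<rightarrow> carrier \<Lambda>" and z: "lincomb a B = \<zero>\<^bsub>V\<^esub>" and v: "v \<in> B"
  have "v \<in> carrier V" "v \<noteq> \<zero>\<^bsub>V\<^esub>" "a v \<in> carrier \<Lambda>" using orthogonal_setD[OF B] a v by auto
  moreover have "l (a v \<odot>\<^bsub>V\<^esub> v) \<le> -\<infinity>" using orthogonal_setD(4)[OF B a v] z l_zero by simp
  ultimately show "a v = \<zero>\<^bsub>\<Lambda>\<^esub>" using l_eq_bot_iff smult_eq_zero_iff by simp
qed

lemma orthogonal_set_insertD:
  assumes B: "orthogonal_set (insert x B)" and x: "x \<notin> B"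
    and t: "t \<in> carrier \<Lambda>" and v: "v \<in> span B"
  shows "l (t \<odot>\<^bsub>V\<^esub> x) \<le> l (t \<odot>\<^bsub>V\<^esub> x \<oplus>\<^bsub>V\<^esub> v)"
proof -
  note o = orthogonal_setD[OF B]
  have fin: "finite B" and B': "B \<subseteq> carrier V" and x': "x \<in> carrier V" using o by auto
  obtain a where a: "a \<in> B \<rightarrow> carrier \<Lambda>" "lincomb a B = v" using finite_in_span[OF fin B' v] by blast
  let ?a = "a(x := t)"
  have a': "?a \<in> insert x B \<rightarrow> carrier \<Lambda>" using a t by auto
  have "lincomb ?a B = lincomb a B" by (rule lincomb_cong) (use B' a x in auto)
  hence "lincomb ?a (insert x B) = t \<odot>\<^bsub>V\<^esub> x \<oplus>\<^bsub>V\<^esub> v"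
    using lincomb_insert2[OF fin B' a' x x'] a by simp
  thus ?thesis using o(4)[OF a', of x] by simp
qed

text \<open>It suffices to test the new vector with coefficient one. Any other nonzero coefficient
  can be divided out, and \<open>l_right_summand_le\<close> then bounds the part lying in the span
  of \<open>B\<close>.\<close>

lemma orthogonal_set_insertI:
  assumes B: "orthogonal_set B" and x: "x \<in> carrier V" "x \<noteq> \<zero>\<^bsub>V\<^esub>"
    and le: "\<And>v. v \<in> span B \<Longrightarrow> l x \<le> l (x \<oplus>\<^bsub>V\<^esub> v)"
  shows "x \<notin> span B" "orthogonal_set (insert x B)"
proof -
  note o = orthogonal_setD[OF B]
  show nspan: "x \<notin> span B"
  proof
    assume "x \<in> span B"
    from le[OF span_neg[OF o(2) this]] show False
      using x l_eq_bot_iff by (simp add: M.r_neg l_zero)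
  qed
  hence xB: "x \<notin> B" using span_mem[OF o(2)] by blast
  show "orthogonal_set (insert x B)"
    unfolding orthogonal_set_def
  proof (intro conjI ballI)
    show "finite (insert x B)" "insert x B \<subseteq> carrier V - {\<zero>\<^bsub>V\<^esub>}" using o x by auto
    fix a v assume a: "a \<in> insert x B \<rightarrow> carrier \<Lambda>" and v: "v \<in> insert x B"
    define w where "w = lincomb a B"
    have w: "w \<in> span B" using a o unfolding w_def span_def by auto
    hence wV: "w \<in> carrier V" using o by simp
    have ax: "a x \<in> carrier \<Lambda>" using a by auto
    have eq: "lincomb a (insert x B) = a x \<odot>\<^bsub>V\<^esub> x \<oplus>\<^bsub>V\<^esub> w"
      unfolding w_def using lincomb_insert2[OF o(1,2) a xB x(1)] .
    have 1: "l (a x \<odot>\<^bsub>V\<^esub> x) \<le> l (a x \<odot>\<^bsub>V\<^esub> x \<oplus>\<^bsub>V\<^esub> w)"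
    proof (cases "a x = \<zero>\<^bsub>\<Lambda>\<^esub>")
      case True
      thus ?thesis using x by (simp add: l_zero)
    next
      case False
      hence u: "a x \<in> Units \<Lambda>" using ax field_Units by auto
      \<comment> \<open>Dividing by the coefficient of \<open>x\<close> keeps the remainder in the
        span, so that \<open>le\<close> applies; multiplying back preserves the inequality.\<close>
      let ?w = "inv\<^bsub>\<Lambda>\<^esub> (a x) \<odot>\<^bsub>V\<^esub> w"
      have i: "inv\<^bsub>\<Lambda>\<^esub> (a x) \<in> carrier \<Lambda>" using u by simp
      have "a x \<odot>\<^bsub>V\<^esub> (x \<oplus>\<^bsub>V\<^esub> ?w) = a x \<odot>\<^bsub>V\<^esub> x \<oplus>\<^bsub>V\<^esub> w"
        using ax i x wV u by (simp add: smult_r_distr smult_assoc1[symmetric])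
      moreover have "l x \<le> l (x \<oplus>\<^bsub>V\<^esub> ?w)" using le span_smult[OF o(2) i w] .
      ultimately show ?thesis using l_smult_mono[OF ax x(1), of "x \<oplus>\<^bsub>V\<^esub> ?w"] x wV i by simp
    qed
    have 2: "l w \<le> l (a x \<odot>\<^bsub>V\<^esub> x \<oplus>\<^bsub>V\<^esub> w)" using l_right_summand_le[OF _ wV 1] ax x by simp
    show "l (a v \<odot>\<^bsub>V\<^esub> v) \<le> l (lincomb a (insert x B))"
    proof (cases "v = x")
      case True
      thus ?thesis using 1 eq by simp
    next
      case False
      hence "l (a v \<odot>\<^bsub>V\<^esub> v) \<le> l w" unfolding w_def using o(4)[of a v] a v by auto
      thus ?thesis using 2 eq by simp
    qed
  qed
qed

text \<open>Steinitz exchange, with the removed vector \<open>e\<close> chosen to carry a dominant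
  term of \<open>x\<close>. The level of \<open>x\<close> is at most that of this term, and adding
  vectors from the span of the others cannot bring the sum below it.\<close>

lemma orthogonal_set_exchange:
  assumes E: "orthogonal_set E" and x: "x \<in> span E" "x \<noteq> \<zero>\<^bsub>V\<^esub>"
  obtains e where "e \<in> E" "x \<notin> span (E - {e})" "orthogonal_set (insert x (E - {e}))"
    "span (insert x (E - {e})) = span E"
proof -
  note o = orthogonal_setD[OF E]
  have xV: "x \<in> carrier V" using x o by simp
  obtain a where a: "a \<in> E \<rightarrow> carrier \<Lambda>" "lincomb a E = x" using finite_in_span[OF o(1,2) x(1)] by blast
  have "E \<noteq> {}" using a x by auto
  then obtain e where e: "e \<in> E" and e_max: "\<And>v. v \<in> E \<Longrightarrow> l (a v \<odot>\<^bsub>V\<^esub> v) \<le> l (a e \<odot>\<^bsub>V\<^esub> e)"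
    using finite_ex_max[OF o(1), of "\<lambda>v. l (a v \<odot>\<^bsub>V\<^esub> v)"] by blast
  let ?E = "E - {e}" and ?c = "a e"
  have lx: "l x \<le> l (?c \<odot>\<^bsub>V\<^esub> e)" using l_lincomb_le[OF o(1,2) a(1) e_max] a(2) by simp
  have E': "?E \<subseteq> carrier V" "finite ?E" and eV: "e \<in> carrier V" and c: "?c \<in> carrier \<Lambda>"
    using o e a by auto
  have ins: "insert e ?E = E" using e by auto
  define w where "w = lincomb a ?E"
  have w: "w \<in> span ?E" using a E' unfolding w_def span_def by auto
  have wV: "w \<in> carrier V" using w E' by simp
  have x_eq: "x = ?c \<odot>\<^bsub>V\<^esub> e \<oplus>\<^bsub>V\<^esub> w" using lincomb_del2[OF o(1,2) a(1) e] a(2) w_def by simp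
  \<comment> \<open>The dominant term bounds the level of the nonzero vector \<open>x\<close>, so it
    cannot vanish.\<close>
  have c0: "?c \<noteq> \<zero>\<^bsub>\<Lambda>\<^esub>"
  proof
    assume "?c = \<zero>\<^bsub>\<Lambda>\<^esub>"
    hence "l x \<le> -\<infinity>" using lx eV by (simp add: l_zero)
    thus False using l_eq_bot_iff[OF xV] x(2) by simp
  qed
  \<comment> \<open>Adding \<open>v\<close> changes only the part \<open>w\<close> outside the term
    at \<open>e\<close>, so orthogonality of \<open>E\<close> still bounds the sum from below by
    that term.\<close>
  have le: "l x \<le> l (x \<oplus>\<^bsub>V\<^esub> v)" if v: "v \<in> span ?E" for v
  proof -
    have "l x \<le> l (?c \<odot>\<^bsub>V\<^esub> e \<oplus>\<^bsub>V\<^esub> (w \<oplus>\<^bsub>V\<^esub> v))"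
      using lx orthogonal_set_insertD[of e ?E ?c "w \<oplus>\<^bsub>V\<^esub> v"] E ins c span_add1[OF E'(1) w v]
      by (auto intro: order_trans)
    thus ?thesis unfolding x_eq using c eV wV span_closed[OF E'(1) v] by (simp add: M.a_assoc)
  qed
  have E'_orth: "orthogonal_set ?E" using orthogonal_set_subset[OF E] by auto
  have u: "?c \<in> Units \<Lambda>" using c c0 field_Units by auto
  \<comment> \<open>The expansion of \<open>x\<close> is solved for \<open>e\<close>, which shows
    that the exchange preserves the span.\<close>
  have cw: "?c \<odot>\<^bsub>V\<^esub> e = x \<oplus>\<^bsub>V\<^esub> \<ominus>\<^bsub>V\<^esub> w"
    unfolding x_eq using c eV wV by (simp add: M.a_assoc M.r_neg)
  have xE: "insert x ?E \<subseteq> carrier V" using xV E' by auto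
  have "?c \<odot>\<^bsub>V\<^esub> e \<in> span (insert x ?E)"
    unfolding cw using span_mem[OF xE] span_neg[OF xE] w span_is_monotone[of ?E "insert x ?E"]
    by (intro span_add1[OF xE]) auto
  hence "inv\<^bsub>\<Lambda>\<^esub> ?c \<odot>\<^bsub>V\<^esub> (?c \<odot>\<^bsub>V\<^esub> e) \<in> span (insert x ?E)" by (rule span_smult[OF xE Units_inv_closed[OF u]])
  moreover have "inv\<^bsub>\<Lambda>\<^esub> ?c \<odot>\<^bsub>V\<^esub> (?c \<odot>\<^bsub>V\<^esub> e) = e"
    using smult_assoc1[of "inv\<^bsub>\<Lambda>\<^esub> ?c" ?c e] u c eV by simp
  ultimately have "e \<in> span (insert x ?E)" by simp
  hence "E \<subseteq> span (insert x ?E)" using span_mem[OF xE] by auto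
  hence "span (insert x ?E) = span E"
    using span_subsetI[OF xE] span_subsetI[OF o(2), of "insert x ?E"] x(1) span_mem[OF o(2)] by auto
  thus ?thesis using that e orthogonal_set_insertI[OF E'_orth xV x(2) le] by blast
qed

section \<open>Passage between orthogonal lists and orthogonal sets\<close>

lemma lincomb_nth:
  assumes ws: "set ws \<subseteq> carrier V" "distinct ws" and c: "c \<in> {..<length ws} \<rightarrow> carrier \<Lambda>"
  obtains a where "a \<in> set ws \<rightarrow> carrier \<Lambda>" "\<And>i. i < length ws \<Longrightarrow> a (ws ! i) = c i"
    "(\<Oplus>\<^bsub>V\<^esub>i\<in>{..<length ws}. c i \<odot>\<^bsub>V\<^esub> ws ! i) = lincomb a (set ws)"
proof -
  let ?I = "{..<length ws}"
  have bij: "bij_betw ((!) ws) ?I (set ws)" using bij_betw_nth[OF ws(2)] by blast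
  \<comment> \<open>In a distinct list each vector has a unique index, from which \<open>a\<close>
    reads its coefficient.\<close>
  define a where "a = (\<lambda>v. c (the_inv_into ?I ((!) ws) v))"
  have a: "a (ws ! i) = c i" if "i < length ws" for i
    unfolding a_def using the_inv_into_f_f[OF bij_betw_imp_inj_on[OF bij], of i] that by simp
  have a': "a \<in> set ws \<rightarrow> carrier \<Lambda>" using a c by (fastforce simp: in_set_conv_nth)
  have "lincomb a (set ws) = (\<Oplus>\<^bsub>V\<^esub>v\<in>(!) ws ` ?I. a v \<odot>\<^bsub>V\<^esub> v)"
    using bij unfolding lincomb_def bij_betw_def by simp
  also have "\<dots> = (\<Oplus>\<^bsub>V\<^esub>i\<in>?I. a (ws ! i) \<odot>\<^bsub>V\<^esub> ws ! i)"
    by (rule finsum_reindex) (use bij a' ws in \<open>auto simp: bij_betw_def\<close>)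
  also have "\<dots> = (\<Oplus>\<^bsub>V\<^esub>i\<in>?I. c i \<odot>\<^bsub>V\<^esub> ws ! i)"
    by (rule M.finsum_cong') (use a c ws in \<open>auto simp: Pi_iff subset_iff\<close>)
  finally show ?thesis using that[of a] a a' by simp
qed

lemma orthogonal_set_imp_list:
  assumes o: "orthogonal_set (set ws)" and d: "distinct ws"
  shows "orthogonal_list K \<Gamma> V l ws"
  unfolding orthogonal_list_def
proof (intro conjI ballI)
  show V: "set ws \<subseteq> carrier V" using orthogonal_setD[OF o] by simp
  fix c assume c: "c \<in> {..<length ws} \<rightarrow> carrier \<Lambda>"
  obtain a where a: "a \<in> set ws \<rightarrow> carrier \<Lambda>" "\<And>i. i < length ws \<Longrightarrow> a (ws ! i) = c i"
    and s: "(\<Oplus>\<^bsub>V\<^esub>i\<in>{..<length ws}. c i \<odot>\<^bsub>V\<^esub> ws ! i) = lincomb a (set ws)"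
    using lincomb_nth[OF V d c] by blast
  let ?M = "insert (-\<infinity>) ((\<lambda>i. l (c i \<odot>\<^bsub>V\<^esub> ws ! i)) ` {..<length ws})"
  have "l (lincomb a (set ws)) = Max ?M"
  proof (rule antisym)
    show "l (lincomb a (set ws)) \<le> Max ?M"
      by (rule l_lincomb_le[OF _ V a(1)]) (auto simp: in_set_conv_nth a(2) intro!: Max_ge)
    have "l (c i \<odot>\<^bsub>V\<^esub> ws ! i) \<le> l (lincomb a (set ws))" if "i < length ws" for i
      using orthogonal_setD(4)[OF o a(1), of "ws ! i"] a(2) that by simp
    thus "Max ?M \<le> l (lincomb a (set ws))" by auto
  qed
  thus "l (\<Oplus>\<^bsub>V\<^esub>i\<in>{..<length ws}. c i \<odot>\<^bsub>V\<^esub> ws ! i) = Max ?M" using s by simp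
qed

lemma orthogonal_list_imp_set:
  assumes o: "orthogonal_list K \<Gamma> V l ws" and d: "distinct ws" and z: "\<zero>\<^bsub>V\<^esub> \<notin> set ws"
  shows "orthogonal_set (set ws)"
  unfolding orthogonal_set_def
proof (intro conjI ballI)
  have V: "set ws \<subseteq> carrier V" using o unfolding orthogonal_list_def by blast
  thus "finite (set ws)" "set ws \<subseteq> carrier V - {\<zero>\<^bsub>V\<^esub>}" using z by auto
  fix a v assume a: "a \<in> set ws \<rightarrow> carrier \<Lambda>" and v: "v \<in> set ws"
  let ?c = "\<lambda>i. a (ws ! i)"
  have c: "?c \<in> {..<length ws} \<rightarrow> carrier \<Lambda>" using a by auto
  obtain a' where a': "a' \<in> set ws \<rightarrow> carrier \<Lambda>" "\<And>i. i < length ws \<Longrightarrow> a' (ws ! i) = ?c i"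
    and s: "(\<Oplus>\<^bsub>V\<^esub>i\<in>{..<length ws}. ?c i \<odot>\<^bsub>V\<^esub> ws ! i) = lincomb a' (set ws)"
    using lincomb_nth[OF V d c] by blast
  \<comment> \<open>The coefficients recovered from the indices agree with \<open>a\<close> on the
    listed vectors, which is all that the combination depends on.\<close>
  have eq: "lincomb a' (set ws) = lincomb a (set ws)"
    by (rule lincomb_cong) (use a a' V in \<open>auto simp: in_set_conv_nth\<close>)
  obtain i where i: "i < length ws" "v = ws ! i" using v by (auto simp: in_set_conv_nth)
  have "l (a v \<odot>\<^bsub>V\<^esub> v) \<le> Max (insert (-\<infinity>) ((\<lambda>i. l (?c i \<odot>\<^bsub>V\<^esub> ws ! i)) ` {..<length ws}))"
    using i by (intro Max_ge) auto
  also have "\<dots> = l (lincomb a' (set ws))"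
    using o c s unfolding orthogonal_list_def by fastforce
  finally show "l (a v \<odot>\<^bsub>V\<^esub> v) \<le> l (lincomb a (set ws))" using eq by simp
qed

section \<open>Orthogonal bases of submodules\<close>

lemma submodule_nonarch:
  assumes "submodule \<Lambda> W V"
  shows "nonarch_normed_space K \<Gamma> (vs W) l"
proof -
  interpret W: vectorspace \<Lambda> "vs W"
    using assms subspace_is_vs[of W] vectorspace_axioms by (simp add: subspace_def)
  have "x \<in> carrier V" if "x \<in> W" for x using that submodule.subset[OF assms] by blast
  thus ?thesis
    by (intro nonarch_normed_space.intro nonarch_normed_space_axioms.intro W.vectorspace_axioms)
      (simp_all add: l_less_top[simplified] l_eq_bot_iff l_smult l_add)
qed

text \<open>Linear combinations and independence are the same in a submodule as in the ambient
  space. With \<open>W\<close> the kernel, the image or a whole carrier, this yields all four basis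
  conditions of a singular value decomposition.\<close>

lemma orthogonal_basis_submodule:
  assumes o: "orthogonal_set (set ws)" and d: "distinct ws" and W: "submodule \<Lambda> W V"
    and span: "span (set ws) = W"
  shows "orthogonal_basis K \<Gamma> (vs W) l ws"
proof -
  interpret W: nonarch_normed_space K \<Gamma> "vs W" l by (rule submodule_nonarch[OF W])
  have sub: "set ws \<subseteq> W" using span_mem orthogonal_setD[OF o] span by blast
  have "W.basis (set ws)"
    using span_li_not_depend[OF sub W] orthogonal_set_lin_indpt[OF o] span sub
    by (simp add: W.basis_def)
  moreover have "W.orthogonal_set (set ws)"
    using o sub lincomb_not_depend[OF _ sub W] by (auto simp: orthogonal_set_def W.orthogonal_set_def)
  ultimately show ?thesis
    using W.orthogonal_set_imp_list d by (simp add: orthogonal_basis_def)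
qed

end


section \<open>Elimination for a linear map between normed spaces\<close>

locale nonarch_linear_map =
  C: nonarch_normed_space K \<Gamma> C lC + D: nonarch_normed_space K \<Gamma> D lD +
  linear_map "novikov_ring K \<Gamma>" C D A
  for K :: "('k, 'm) ring_scheme" and \<Gamma> :: "real set"
    and C :: "(real \<Rightarrow> 'k, 'c, 'p) module_scheme" and lC :: "'c \<Rightarrow> ereal"
    and D :: "(real \<Rightarrow> 'k, 'd, 'q) module_scheme" and lD :: "'d \<Rightarrow> ereal"
    and A :: "'c \<Rightarrow> 'd"
begin

text \<open>Injectivity on a span whose generators have distinct, orthogonal images. If the image of
  a combination vanishes, orthogonality forces the coefficient of each generator to be zero, one
  after the other. This later confines the kernel to the vectors that are not pivots.\<close>

lemma orthogonal_image_inj: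
  assumes "finite P" "P \<subseteq> carrier C" "inj_on A P" "D.orthogonal_set (A ` P)"
    and "v \<in> C.span P" "A v = \<zero>\<^bsub>D\<^esub>"
  shows "v = \<zero>\<^bsub>C\<^esub>"
  using assms
proof (induction P arbitrary: v rule: finite_induct)
  case empty
  thus ?case by (simp add: C.span_empty)
next
  case (insert x P)
  have P: "P \<subseteq> carrier C" and x: "x \<in> carrier C" using insert.prems by auto
  have Ax: "A x \<notin> A ` P" and inj: "inj_on A P" using insert by (auto simp: inj_on_def)
  have oD: "D.orthogonal_set (insert (A x) (A ` P))" using insert.prems(3) by simp
  obtain t w where t: "t \<in> carrier C.\<Lambda>" and w: "w \<in> C.span P"
    and v: "v = t \<odot>\<^bsub>C\<^esub> x \<oplus>\<^bsub>C\<^esub> w"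
    using C.span_insertE[OF insert.hyps(1) P x insert.prems(4)] by blast
  have wC: "w \<in> carrier C" using w P by simp
  have Aw: "A w \<in> D.span (A ` P)" using image_span[OF insert.hyps(1) P] w by blast
  have Av: "t \<odot>\<^bsub>D\<^esub> A x \<oplus>\<^bsub>D\<^esub> A w = \<zero>\<^bsub>D\<^esub>" using insert.prems(5) v t x wC by simp
  have Axc: "A x \<in> carrier D" "A x \<noteq> \<zero>\<^bsub>D\<^esub>" using D.orthogonal_setD[OF oD] by auto
  have "lD (t \<odot>\<^bsub>D\<^esub> A x) \<le> -\<infinity>"
    using D.orthogonal_set_insertD[OF oD Ax t Aw] Av D.l_zero by simp
  hence "t \<odot>\<^bsub>D\<^esub> A x = \<zero>\<^bsub>D\<^esub>" using D.l_eq_bot_iff t Axc by simp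
  hence "t = \<zero>\<^bsub>C.\<Lambda>\<^esub>" using D.smult_eq_zero_iff[OF t Axc(1)] Axc(2) by blast
  hence vw: "v = w" using v x wC by simp
  show ?case
    using insert.IH[OF P inj D.orthogonal_set_subset[OF insert.prems(3)], of v] vw w insert.prems(5)
    by auto
qed

text \<open>Each \<open>c\<close> in \<open>B\<close> is replaced by \<open>c - t y\<close>, where
  \<open>t\<close> is the coefficient of \<open>x\<close> in \<open>A c\<close>. Orthogonality in
  \<open>D\<close> bounds \<open>t x\<close> by \<open>A c\<close>, and the gain hypothesis turns
  this into a bound of \<open>t y\<close> by \<open>c\<close>. Hence the level of \<open>c\<close>
  is unchanged and orthogonality survives. The cardinality is recorded for the induction in
  \<open>orthogonal_split\<close>.\<close>

lemma clear_column:
  assumes x: "x = A y" "D.orthogonal_set (insert x E)" "x \<notin> E"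
    and y: "y \<in> carrier C" "y \<noteq> \<zero>\<^bsub>C\<^esub>"
    and "finite B" "C.orthogonal_set (insert y B)" "y \<notin> B"
    and "\<And>c. c \<in> B \<Longrightarrow> lD (A c) - lC c \<le> lD x - lC y"
    and "A ` B \<subseteq> D.span (insert x E)"
  shows "\<exists>B'. C.orthogonal_set (insert y B') \<and> y \<notin> B' \<and> card B' = card B \<and>
    C.span (insert y B') = C.span (insert y B) \<and> A ` B' \<subseteq> D.span E"
  using assms(6-)
proof (induction B rule: finite_induct)
  case empty
  thus ?case by (intro exI[of _ "{}"]) simp
next
  case (insert c B)
  have c: "c \<in> carrier C" "c \<noteq> \<zero>\<^bsub>C\<^esub>" "c \<noteq> y" and B: "B \<subseteq> carrier C" and yB: "y \<notin> B"
    using C.orthogonal_setD[OF insert.prems(1)] insert.prems(2) by auto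
  obtain B' where B': "C.orthogonal_set (insert y B')" "y \<notin> B'" "card B' = card B"
    "C.span (insert y B') = C.span (insert y B)" "A ` B' \<subseteq> D.span E"
    using insert.IH[OF C.orthogonal_set_subset[OF insert.prems(1)]] insert.prems by auto
  note o' = C.orthogonal_setD[OF B'(1)]
  have yB'C: "insert y B' \<subseteq> carrier C" and yBC: "insert y B \<subseteq> carrier C"
    and cyBC: "insert y (insert c B) \<subseteq> carrier C"
    using o' y B c by auto
  have E: "E \<subseteq> carrier D" "finite E" and xD: "x \<in> carrier D" "x \<noteq> \<zero>\<^bsub>D\<^esub>"
    using D.orthogonal_setD[OF x(2)] by auto
  have "A c \<in> D.span (insert x E)" using insert.prems by auto
  then obtain t w where t: "t \<in> carrier C.\<Lambda>" and w: "w \<in> D.span E"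
    and Ac: "A c = t \<odot>\<^bsub>D\<^esub> x \<oplus>\<^bsub>D\<^esub> w"
    using D.span_insertE[OF E(2,1) xD(1)] by blast
  have wD: "w \<in> carrier D" using w E by simp
  \<comment> \<open>The two inequalities are added and the finite levels cancelled. The case
    analysis covers \<open>t = 0\<close>, where the valuation is \<infinity>, and
    \<open>A c = 0\<close>, where the level is -\<infinity>.\<close>
  have le: "lC (t \<odot>\<^bsub>C\<^esub> y) \<le> lC c"
  proof -
    have "lD x - novikov_val K t \<le> lD (A c)"
      using D.orthogonal_set_insertD[OF x(2,3) t w] D.l_smult[OF t xD(1)] Ac by simp
    moreover have "lD (A c) - lC c \<le> lD x - lC y" using insert.prems(3) by simp
    moreover have "lC y - novikov_val K t < \<infinity>" "lC (t \<odot>\<^bsub>C\<^esub> y) = lC y - novikov_val K t"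
      using C.l_less_top[of "t \<odot>\<^bsub>C\<^esub> y"] C.l_smult[OF t y(1)] t y(1) by auto
    moreover have "lD (A c) < \<infinity>" using D.l_less_top c by simp
    ultimately show ?thesis using C.l_finite[OF y] C.l_finite[OF c(1,2)] D.l_finite[OF xD]
      by (cases "lC y"; cases "lC c"; cases "lD x"; cases "lD (A c)"; cases "novikov_val K t") auto
  qed
  define z where "z = \<ominus>\<^bsub>C\<^esub> (t \<odot>\<^bsub>C\<^esub> y)"
  define c' where "c' = c \<oplus>\<^bsub>C\<^esub> z"
  have z: "z \<in> carrier C" "lC z \<le> lC c" using le t y C.l_uminus by (auto simp: z_def)
  have c'C: "c' \<in> carrier C" using c z by (simp add: c'_def)
  have y_span: "y \<in> C.span (insert y B')" "y \<in> C.span (insert y B)"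
    using C.span_mem[OF yB'C] C.span_mem[OF yBC] by auto
  have z_span: "z \<in> C.span (insert y B')"
    unfolding z_def using C.span_neg[OF yB'C] C.span_smult[OF yB'C t] y_span by blast
  have cB: "c \<notin> insert y B" using insert.hyps c by auto
  \<comment> \<open>The vectors of \<open>B\<close> have already been modified, but the span
    together with \<open>y\<close> has not, so \<open>c\<close> remains orthogonal to it.\<close>
  have key: "lC c \<le> lC (c \<oplus>\<^bsub>C\<^esub> v)" if v: "v \<in> C.span (insert y B')" for v
  proof -
    have "C.orthogonal_set (insert c (insert y B))" using insert.prems(1) by (simp add: insert_commute)
    from C.orthogonal_set_insertD[OF this cB, of "\<one>\<^bsub>C.\<Lambda>\<^esub>" v] show ?thesis
      using v B'(4) c by simp
  qed
  have c'le: "lC c' \<le> lC c" unfolding c'_def using C.l_add[OF c(1) z(1)] z(2) by simp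
  \<comment> \<open>The correction \<open>z\<close> lies in the same span and is absorbed into
    \<open>v\<close>.\<close>
  have key': "lC c' \<le> lC (c' \<oplus>\<^bsub>C\<^esub> v)" if v: "v \<in> C.span (insert y B')" for v
  proof -
    have "lC c \<le> lC (c \<oplus>\<^bsub>C\<^esub> (z \<oplus>\<^bsub>C\<^esub> v))" using key C.span_add1[OF yB'C z_span v] by blast
    also have "c \<oplus>\<^bsub>C\<^esub> (z \<oplus>\<^bsub>C\<^esub> v) = c' \<oplus>\<^bsub>C\<^esub> v"
      unfolding c'_def using c z C.span_closed[OF yB'C v] by (simp add: C.M.a_assoc)
    finally show ?thesis using c'le by simp
  qed
  have "lC c \<le> lC c'" using key[OF z_span] by (simp add: c'_def)
  hence c'0: "c' \<noteq> \<zero>\<^bsub>C\<^esub>" using C.l_finite[OF c(1,2)] C.l_zero by auto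
  note o'' = C.orthogonal_set_insertI[OF B'(1) c'C c'0 key']
  have c'nin: "c' \<notin> insert y B'" using o''(1) C.span_mem[OF yB'C] by blast
  have Ac': "A c' = w"
  proof -
    have "A c' = (t \<odot>\<^bsub>D\<^esub> x \<oplus>\<^bsub>D\<^esub> w) \<oplus>\<^bsub>D\<^esub> \<ominus>\<^bsub>D\<^esub> (t \<odot>\<^bsub>D\<^esub> x)"
      unfolding c'_def using c z t y by (simp add: z_def Ac x(1))
    thus ?thesis using D.add_minus_cancel[of "t \<odot>\<^bsub>D\<^esub> x" w] t xD wD by simp
  qed
  \<comment> \<open>The vectors \<open>c\<close> and \<open>c'\<close> differ by \<open>z\<close>,
    which lies in both spans.\<close>
  have span_eq: "C.span (insert y (insert c' B')) = C.span (insert y (insert c B))"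
  proof (rule antisym)
    have c'yC: "insert y (insert c' B') \<subseteq> carrier C" using yB'C c'C by auto
    have sub: "C.span (insert y B) \<subseteq> C.span (insert y (insert c B))"
      "C.span (insert y B') \<subseteq> C.span (insert y (insert c' B'))"
      by (rule C.span_is_monotone, blast)+
    have "c' \<in> C.span (insert y (insert c B))"
      unfolding c'_def using C.span_mem[OF cyBC, of c] z_span B'(4) sub C.span_add1[OF cyBC] by blast
    thus "C.span (insert y (insert c' B')) \<subseteq> C.span (insert y (insert c B))"
      using C.span_mem[OF yB'C] B'(4) sub by (intro C.span_subsetI[OF cyBC]) blast
    have "c = c' \<oplus>\<^bsub>C\<^esub> \<ominus>\<^bsub>C\<^esub> z"
      unfolding c'_def using c z by (simp add: C.M.a_assoc C.M.r_neg)
    moreover have "\<ominus>\<^bsub>C\<^esub> z \<in> C.span (insert y (insert c' B'))"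
      using C.span_neg[OF yB'C z_span] sub by blast
    ultimately have "c \<in> C.span (insert y (insert c' B'))"
      using C.span_add1[OF c'yC C.span_mem[OF c'yC, of c']] by simp
    thus "C.span (insert y (insert c B)) \<subseteq> C.span (insert y (insert c' B'))"
      using C.span_mem[OF yBC] B'(4) sub by (intro C.span_subsetI[OF c'yC]) blast
  qed
  show ?case
  proof (intro exI[of _ "insert c' B'"] conjI span_eq)
    show "C.orthogonal_set (insert y (insert c' B'))" using o''(2) by (simp add: insert_commute)
    show "y \<notin> insert c' B'" using B'(2) c'nin by auto
    show "card (insert c' B') = card (insert c B)"
      using B'(3) c'nin o'(1) insert.hyps by simp
    show "A ` insert c' B' \<subseteq> D.span E" using B'(5) Ac' w by auto
  qed
qed

lemma orthogonal_split:
  assumes "C.orthogonal_set B" "D.orthogonal_set E" "A ` B \<subseteq> D.span E"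
  shows "\<exists>P N F. P \<inter> N = {} \<and> C.orthogonal_set (P \<union> N) \<and> C.span (P \<union> N) = C.span B \<and>
    inj_on A P \<and> A ` P \<inter> F = {} \<and> D.orthogonal_set (A ` P \<union> F) \<and>
    D.span (A ` P \<union> F) = D.span E \<and> A ` N \<subseteq> {\<zero>\<^bsub>D\<^esub>}"
  using assms
proof (induction "card B" arbitrary: B E rule: less_induct)
  case less
  note oB = C.orthogonal_setD[OF less.prems(1)] and oE = D.orthogonal_setD[OF less.prems(2)]
  show ?case
  proof (cases "A ` B \<subseteq> {\<zero>\<^bsub>D\<^esub>}")
    case True
    \<comment> \<open>No pivot is left: everything in \<open>B\<close> is a kernel vector, and all
      of \<open>E\<close> is the completion.\<close>
    thus ?thesis using less.prems by (intro exI[of _ "{}"] exI[of _ B] exI[of _ E]) simp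
  next
    case False
    then obtain b where b: "b \<in> B" "A b \<noteq> \<zero>\<^bsub>D\<^esub>" by blast
    obtain y where y: "y \<in> B" and y_max: "\<And>c. c \<in> B \<Longrightarrow> lD (A c) - lC c \<le> lD (A y) - lC y"
      using finite_ex_max[OF oB(1), of "\<lambda>c. lD (A c) - lC c"] b by blast
    define x where "x = A y"
    have yC: "y \<in> carrier C" "y \<noteq> \<zero>\<^bsub>C\<^esub>" using oB y by auto
    have xD: "x \<in> carrier D" using yC by (simp add: x_def)
    \<comment> \<open>A zero image has gain -\<infinity>, whereas \<open>b\<close> has finite gain,
      so a maximizer cannot have zero image.\<close>
    have x0: "x \<noteq> \<zero>\<^bsub>D\<^esub>"
    proof
      assume "x = \<zero>\<^bsub>D\<^esub>"
      hence "lD (A b) - lC b \<le> -\<infinity> - lC y" using y_max[OF b(1)] by (simp add: x_def D.l_zero)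
      moreover have "b \<in> carrier C" "b \<noteq> \<zero>\<^bsub>C\<^esub>" using oB b by auto
      ultimately show False
        using C.l_finite[OF yC] C.l_finite[of b] D.l_finite[of "A b"] b
        by (cases "lC y"; cases "lC b"; cases "lD (A b)") auto
    qed
    have "x \<in> D.span E" using less.prems(3) y by (auto simp: x_def)
    then obtain e where e: "e \<in> E" "x \<notin> D.span (E - {e})" "D.orthogonal_set (insert x (E - {e}))"
      "D.span (insert x (E - {e})) = D.span E"
      using D.orthogonal_set_exchange[OF less.prems(2) _ x0] by blast
    let ?E = "E - {e}"
    have E: "?E \<subseteq> carrier D" using oE by auto
    have ins: "insert y (B - {y}) = B" using y by auto
    have "\<exists>B'. C.orthogonal_set (insert y B') \<and> y \<notin> B' \<and> card B' = card (B - {y}) \<and>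
      C.span (insert y B') = C.span (insert y (B - {y})) \<and> A ` B' \<subseteq> D.span ?E"
    proof (rule clear_column[OF x_def e(3) _ yC])
      show "x \<notin> ?E" using e(2) D.span_mem[OF E] by blast
      show "lD (A c) - lC c \<le> lD x - lC y" if "c \<in> B - {y}" for c
        using y_max that by (simp add: x_def)
    qed (use less.prems oB ins e(4) in auto)
    then obtain B' where B': "C.orthogonal_set (insert y B')" "y \<notin> B'" "card B' = card (B - {y})"
      "C.span (insert y B') = C.span B" "A ` B' \<subseteq> D.span ?E"
      unfolding ins by blast
    have oB': "C.orthogonal_set B'" using C.orthogonal_set_subset[OF B'(1)] by blast
    have oE': "D.orthogonal_set ?E" using D.orthogonal_set_subset[OF less.prems(2)] by blast
    have "card B' < card B" using B'(3) card_Diff1_less[OF oB(1) y] by simp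
    from less.hyps[OF this oB' oE' B'(5)] obtain P N F where
      IH: "P \<inter> N = {}" "C.orthogonal_set (P \<union> N)" "C.span (P \<union> N) = C.span B'"
        "inj_on A P" "A ` P \<inter> F = {}" "D.orthogonal_set (A ` P \<union> F)"
        "D.span (A ` P \<union> F) = D.span ?E" "A ` N \<subseteq> {\<zero>\<^bsub>D\<^esub>}"
      by (elim exE conjE) (rule that)
    have B'C: "B' \<subseteq> carrier C" using C.orthogonal_setD[OF oB'] by simp
    have PNC: "P \<union> N \<subseteq> carrier C" and PFD: "A ` P \<union> F \<subseteq> carrier D"
      using C.orthogonal_setD[OF IH(2)] D.orthogonal_setD[OF IH(6)] by auto
    \<comment> \<open>Orthogonality of \<open>y\<close> to \<open>B'\<close> depends only on the
      span, which the recursive splitting preserves. The same argument puts \<open>x\<close> back in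
      \<open>D\<close>.\<close>
    have "lC y \<le> lC (y \<oplus>\<^bsub>C\<^esub> v)" if "v \<in> C.span (P \<union> N)" for v
      using C.orthogonal_set_insertD[OF B'(1,2), of "\<one>\<^bsub>C.\<Lambda>\<^esub>" v] that IH(3) yC by simp
    note y_new = C.orthogonal_set_insertI[OF IH(2) yC this]
    have "lD x \<le> lD (x \<oplus>\<^bsub>D\<^esub> v)" if "v \<in> D.span (A ` P \<union> F)" for v
      using D.orthogonal_set_insertD[OF e(3), of "\<one>\<^bsub>C.\<Lambda>\<^esub>" v] that IH(7) xD e(2) D.span_mem[OF E]
      by (cases "x \<in> ?E") auto
    note x_new = D.orthogonal_set_insertI[OF IH(6) xD x0 this]
    have yn: "y \<notin> P \<union> N" and xn: "x \<notin> A ` P \<union> F"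
      using y_new(1) C.span_mem[OF PNC] x_new(1) D.span_mem[OF PFD] by blast+
    have "C.span (insert y (P \<union> N)) = C.span (insert y B')"
      using C.span_Un[of "{y}" "{y}" "P \<union> N" B'] yC PNC B'C IH(3) by simp
    moreover have "D.span (insert x (A ` P \<union> F)) = D.span (insert x ?E)"
      using D.span_Un[of "{x}" "{x}" "A ` P \<union> F" ?E] xD PFD E IH(7) by simp
    ultimately show ?thesis
      using IH B'(4) e(4) yn xn y_new(2) x_new(2)
      by (intro exI[of _ "insert y P"] exI[of _ N] exI[of _ F]) (simp add: x_def[symmetric])
  qed
qed

section \<open>Assembling the decomposition from the splitting\<close>

lemma svd_exists:
  assumes B: "orthogonal_basis K \<Gamma> C lC ws" and E: "orthogonal_basis K \<Gamma> D lD us"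
  shows "\<exists>ys xs. singular_value_decomposition K \<Gamma> C lC D lD A ys xs"
proof -
  have bB: "C.basis (set ws)" and bE: "D.basis (set us)"
    using B E by (auto simp: orthogonal_basis_def)
  have oB: "C.orthogonal_set (set ws)"
    using B bB C.vs_zero_lin_dep
    by (intro C.orthogonal_list_imp_set) (auto simp: orthogonal_basis_def C.basis_def)
  have oE: "D.orthogonal_set (set us)"
    using E bE D.vs_zero_lin_dep
    by (intro D.orthogonal_list_imp_set) (auto simp: orthogonal_basis_def D.basis_def)
  have spB: "C.span (set ws) = carrier C" and spE: "D.span (set us) = carrier D"
    using bB bE by (auto simp: C.basis_def D.basis_def)
  have "A ` set ws \<subseteq> D.span (set us)" using C.orthogonal_setD(2)[OF oB] spE by auto
  from orthogonal_split[OF oB oE this] obtain P N F where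
    PN: "P \<inter> N = {}" "C.orthogonal_set (P \<union> N)" and spPN: "C.span (P \<union> N) = carrier C"
    and inj: "inj_on A P" and PF: "A ` P \<inter> F = {}" "D.orthogonal_set (A ` P \<union> F)"
    and spPF: "D.span (A ` P \<union> F) = carrier D" and AN: "A ` N \<subseteq> {\<zero>\<^bsub>D\<^esub>}"
    unfolding spB spE by (elim exE conjE) (rule that)
  have finP: "finite P" and finN: "finite N" and finF: "finite F"
    and P: "P \<subseteq> carrier C" and N: "N \<subseteq> carrier C" and AP: "A ` P \<subseteq> carrier D"
    using C.orthogonal_setD[OF PN(2)] D.orthogonal_setD[OF PF(2)] by auto
  have oAP: "D.orthogonal_set (A ` P)" using D.orthogonal_set_subset[OF PF(2)] by blast
  have oN: "C.orthogonal_set N" using C.orthogonal_set_subset[OF PN(2)] by blast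

  have im: "D.span (A ` P) = im"
  proof
    show "D.span (A ` P) \<subseteq> im"
      by (rule D.span_is_subset[OF _ im_is_submodule]) (use P in \<open>auto simp: im_def\<close>)
    \<comment> \<open>The map kills \<open>N\<close>, so the images of the pivots alone span the
      image.\<close>
    have "im = D.span (A ` (P \<union> N))"
      using image_span[of "P \<union> N"] spPN finP finN P N by (simp add: im_def)
    also have "\<dots> \<subseteq> D.span (A ` P)"
      using AN D.span_mem[OF AP] D.span_zero by (intro D.span_subsetI[OF AP]) auto
    finally show "im \<subseteq> D.span (A ` P)" .
  qed
  have ker: "C.span N = ker"
  proof
    show "C.span N \<subseteq> ker"
      by (rule C.span_is_subset[OF _ ker_is_submodule]) (use AN N in \<open>auto simp: ker_def\<close>)
    show "ker \<subseteq> C.span N"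
    proof
      fix v assume "v \<in> ker"
      hence vC: "v \<in> carrier C" and Av: "A v = \<zero>\<^bsub>D\<^esub>" by (auto simp: ker_def)
      obtain a where a: "a \<in> P \<union> N \<rightarrow> carrier C.\<Lambda>" "C.lincomb a (P \<union> N) = v"
        using C.finite_in_span[of "P \<union> N" v] spPN vC finP finN P N by auto
      define p n where "p = C.lincomb a P" and "n = C.lincomb a N"
      have p: "p \<in> C.span P" and n: "n \<in> C.span N"
        using a finP finN unfolding p_def n_def C.span_def by auto
      have pC: "p \<in> carrier C" and nC: "n \<in> carrier C" using p n P N by auto
      \<comment> \<open>A kernel vector splits into a pivot part and a kernel part. The pivot part
        is then itself in the kernel, hence zero by \<open>orthogonal_image_inj\<close>.\<close>
      have v: "v = p \<oplus>\<^bsub>C\<^esub> n"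
        using C.lincomb_union[OF P N PN(1) finP finN a(1)] a(2) by (simp add: p_def n_def)
      have "A n = \<zero>\<^bsub>D\<^esub>" using n \<open>C.span N \<subseteq> ker\<close> by (auto simp: ker_def)
      hence "A p = \<zero>\<^bsub>D\<^esub>" using Av v pC nC by simp
      hence "p = \<zero>\<^bsub>C\<^esub>" using orthogonal_image_inj[OF finP P inj oAP p] by simp
      thus "v \<in> C.span N" using v n nC by simp
    qed
  qed

  let ?gap = "\<lambda>p. lC p - lD (A p)"
  obtain ps0 where ps0: "set ps0 = P" "distinct ps0" using finite_distinct_list[OF finP] by blast
  obtain ns where ns: "set ns = N" "distinct ns" using finite_distinct_list[OF finN] by blast
  obtain fs where fs: "set fs = F" "distinct fs" using finite_distinct_list[OF finF] by blast
  \<comment> \<open>\<open>sort_key\<close> sorts in increasing order, while the singular values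
    must decrease. Reordering is harmless because orthogonality and span depend only on the
    underlying set.\<close>
  define ps where "ps = rev (sort_key ?gap ps0)"
  have ps: "set ps = P" "distinct ps" using ps0 by (simp_all add: ps_def)
  have sorted: "?gap (ps ! Suc i) \<le> ?gap (ps ! i)" if "Suc i < length ps" for i
  proof -
    have "sorted (map ?gap (rev ps))" by (simp add: ps_def)
    hence "sorted_wrt (\<lambda>x y. y \<le> x) (map ?gap ps)" by (simp add: rev_map[symmetric] sorted_wrt_rev)
    from sorted_wrt_nth_less[OF this, of i "Suc i"] show ?thesis using that by simp
  qed

  \<comment> \<open>Treating the whole spaces as submodules of themselves lets
    \<open>orthogonal_basis_submodule\<close> cover them too.\<close>
  have carC: "submodule C.\<Lambda> (carrier C) C" and carD: "submodule C.\<Lambda> (carrier D) D"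
    using C.span_is_submodule[of "P \<union> N"] D.span_is_submodule[of "A ` P \<union> F"]
      spPN spPF P N D.orthogonal_setD(2)[OF PF(2)] by auto
  have ys: "orthogonal_basis K \<Gamma> C lC (ps @ ns)"
    using C.orthogonal_basis_submodule[of "ps @ ns", OF _ _ carC] PN spPN ps ns by simp
  have xs: "orthogonal_basis K \<Gamma> D lD (map A ps @ fs)"
    using D.orthogonal_basis_submodule[of "map A ps @ fs", OF _ _ carD] PF spPF ps fs inj
    by (simp add: distinct_map)
  have ys_ker: "orthogonal_basis K \<Gamma> (C\<lparr>carrier := ker\<rparr>) lC ns"
    using C.orthogonal_basis_submodule[OF _ ns(2) ker_is_submodule] ker ns(1) oN by simp
  have xs_im: "orthogonal_basis K \<Gamma> (D\<lparr>carrier := im\<rparr>) lD (map A ps)"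
    using D.orthogonal_basis_submodule[OF _ _ im_is_submodule, of "map A ps"] im ps oAP inj
    by (simp add: distinct_map)
  interpret Im: nonarch_normed_space K \<Gamma> "D\<lparr>carrier := im\<rparr>" lD
    by (rule D.submodule_nonarch[OF im_is_submodule])
  have "Im.basis (A ` P)" using xs_im ps by (simp add: orthogonal_basis_def)
  hence "Im.dim = card (A ` P)" using Im.dim_basis finP by blast
  \<comment> \<open>The rank is the number of pivots, so \<open>drop r\<close> and
    \<open>take r\<close> cut both concatenated lists exactly at their seam.\<close>
  hence "rank C.\<Lambda> C D A = length ps"
    using card_image[OF inj] distinct_card[OF ps(2)] ps(1) by (simp add: rank_def)
  hence "singular_value_decomposition K \<Gamma> C lC D lD A (ps @ ns) (map A ps @ fs)"
    unfolding singular_value_decomposition_def Let_def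
    using ys xs ys_ker xs_im sorted by (simp add: nth_append)
  thus ?thesis by blast
qed

end

theorem theorem3p4:
  fixes K :: "('k, 'm) ring_scheme"
    and \<Gamma> :: "real set"
    and C :: "(real \<Rightarrow> 'k, 'c, 'p) module_scheme" and lC :: "'c \<Rightarrow> ereal"
    and D :: "(real \<Rightarrow> 'k, 'd, 'q) module_scheme" and lD :: "'d \<Rightarrow> ereal"
    and A :: "'c \<Rightarrow> 'd"
  assumes "field K"
    and "subgroup \<Gamma> real_group"
    and "orthogonalizable_space K \<Gamma> C lC"
    and "orthogonalizable_space K \<Gamma> D lD"
    and "linear_map (novikov_ring K \<Gamma>) C D A"
  shows "\<exists>ys xs. singular_value_decomposition K \<Gamma> C lC D lD A ys xs"
proof -
  have "nonarch_linear_map K \<Gamma> C lC D lD A"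
    using assms(3-5) by (simp add: nonarch_linear_map_def orthogonalizable_space_def)
  then interpret nonarch_linear_map K \<Gamma> C lC D lD A .
  show ?thesis using svd_exists assms(3,4) unfolding orthogonalizable_space_def by blast
qed

end
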